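(* For any generalized Haar system $\mathcal H$ we have $\mathcal K_n(\mathcal H)\sim\sqrt{\log n}$; that is, there are constants $c_1,c_2>0$ such that $$c_1\sqrt{\log n}\le \mathcal K_n(\mathcal H)\le c_2\sqrt{\log n}\qquad\text{for all integers } n\ge2.$$
   Context: Functions are real-valued, on $[0,1)$ with Lebesgue measure; $\log$ has base $2$. A partition of $[0,1)$ is a sequence of pairwise disjoint measurable sets with union $[0,1)$. A filtration is a sequence $\mathcal A_n$, $n=1,2,\ldots$, of partitions of $[0,1)$ such that every $A\in\mathcal A_n$ is a union of some sets from $\mathcal A_{n+1}$ (called children of $A$). A martingale difference based on a filtration $\{\mathcal A_n\}$ is a sequence of functions $f_n\in L^1(0,1)$, $n=1,2,\ldots$, such that (1) $f_n$ is constant on each $A\in\mathcal A_n$; (2) $\int_A f_n=0$ for every $A\in\mathcal A_{n-1}$, $n\ge2$. A generalized Haar system is an $L^2$-normalized ($\|f_n\|_2=1$) martingale difference based on a filtration $\{\mathcal A_n\}$ such that: $\mathcal A_1=\{[0,1)\}$; for each $n\ge1$, $\mathcal A_{n+1}$ is obtained from $\mathcal A_n$ by splitting exactly one interval $[\alpha,\beta)\in\mathcal A_n$ into two intervals $[\alpha,\gamma)$, $[\gamma,\beta)$ with $\alpha<\gamma<\beta$ (all other intervals being kept); and $\max_{A\in\mathcal A_n}|A|\to0$ as $n\to\infty$. For an infinite orthogonal system $\Phi=\{\phi_k\}_{k\ge1}\subset L^2(0,1)$ of nonzero functions, let $\mathcal P_n(\Phi)$ be the family of all monotonic sequences of $\Phi$-polynomials,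 i.e. all $n$-tuples $(p_1,\ldots,p_n)$ of the form $p_k=\sum_{j\in G_k}c_j\phi_j$, $k=1,\ldots,n$, where $G_1\subset G_2\subset\cdots\subset G_n\subset\mathbb N$ are finite sets, the real coefficients $c_j$ do not depend on $k$, and $\sum_{j\in G_n}c_j^2\ne0$. Define $$\mathcal K_n(\Phi)=\sup_{\{p_k\}\in\mathcal P_n(\Phi)}\frac{\left\|\max_{1\le m\le n}|p_m|\right\|_2}{\|p_n\|_2}.$$ *)

theory Defs
  imports "HOL-Analysis.Analysis"
begin

text \<open>
  Functions on \<open>[0,1)\<close> are represented by total functions on the reals whose values outside
  \<open>[0,1)\<close> play no role. Sequences are indexed by \<open>n \<ge> 1\<close>; index \<open>0\<close> is never used.
\<close>

abbreviation unit_lebesgue :: "real measure" where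
  "unit_lebesgue \<equiv> lebesgue_on {0..<1}"

definition L2_norm :: "(real \<Rightarrow> real) \<Rightarrow> real" where
  "L2_norm f = sqrt (\<integral>x. (f x)\<^sup>2 \<partial>unit_lebesgue)"

definition unit_partition :: "real set set \<Rightarrow> bool" where
  "unit_partition P \<longleftrightarrow>
     countable P \<and> P \<subseteq> sets lebesgue \<and> disjoint P \<and> \<Union>P = {0..<1}"

definition filtration :: "(nat \<Rightarrow> real set set) \<Rightarrow> bool" where
  "filtration \<A> \<longleftrightarrow>
     (\<forall>n\<ge>1. unit_partition (\<A> n)) \<and>
     (\<forall>n\<ge>1. \<forall>A\<in>\<A> n. \<exists>\<B>\<subseteq>\<A> (Suc n). A = \<Union>\<B>)"

definition martingale_difference ::
    "(nat \<Rightarrow> real set set) \<Rightarrow> (nat \<Rightarrow> real \<Rightarrow> real) \<Rightarrow> bool" where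
  "martingale_difference \<A> f \<longleftrightarrow>
     filtration \<A> \<and>
     (\<forall>n\<ge>1. integrable unit_lebesgue (f n)) \<and>
     (\<forall>n\<ge>1. \<forall>A\<in>\<A> n. f n constant_on A) \<and>
     (\<forall>n\<ge>2. \<forall>A\<in>\<A> (n - 1). (LINT x:A|lebesgue. f n x) = 0)"

definition haar_filtration :: "(nat \<Rightarrow> real set set) \<Rightarrow> bool" where
  "haar_filtration \<A> \<longleftrightarrow>
     filtration \<A> \<and>
     \<A> 1 = {{0..<1}} \<and>
     (\<forall>n\<ge>1. \<exists>\<alpha> \<gamma> \<beta>. \<alpha> < \<gamma> \<and> \<gamma> < \<beta> \<and> {\<alpha>..<\<beta>} \<in> \<A> n \<and>
        \<A> (Suc n) = (\<A> n - {{\<alpha>..<\<beta>}}) \<union> {{\<alpha>..<\<gamma>}, {\<gamma>..<\<beta>}}) \<and>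
     (\<lambda>n. MAX A\<in>\<A> n. measure lebesgue A) \<longlonglongrightarrow> 0"

text \<open>
  A non-integrable square would have Bochner integral \<open>0\<close>, so \<open>L2_norm (h n) = 1\<close> includes
  square integrability of \<open>h n\<close>.
\<close>

definition generalized_haar_system :: "(nat \<Rightarrow> real \<Rightarrow> real) \<Rightarrow> bool" where
  "generalized_haar_system h \<longleftrightarrow>
     (\<exists>\<A>. haar_filtration \<A> \<and> martingale_difference \<A> h \<and> (\<forall>n\<ge>1. L2_norm (h n) = 1))"

text \<open>
  An \<open>n\<close>-tuple \<open>(p\<^sub>1, \<dots>, p\<^sub>n)\<close> is represented by any \<open>p\<close> having these values at \<open>1, \<dots>, n\<close>.
  Since coefficients may vanish, strict and non-strict inclusions between the spectra \<open>G k\<close>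
  give the same tuples.
\<close>

definition monotonic_polynomials ::
    "(nat \<Rightarrow> real \<Rightarrow> real) \<Rightarrow> nat \<Rightarrow> (nat \<Rightarrow> real \<Rightarrow> real) set" where
  "monotonic_polynomials \<Phi> n = {p. \<exists>G c.
     (\<forall>k\<in>{1..n}. finite (G k) \<and> G k \<subseteq> {1..}) \<and>
     (\<forall>k\<in>{1..<n}. G k \<subseteq> G (Suc k)) \<and>
     (\<forall>k\<in>{1..n}. p k = (\<lambda>x. \<Sum>j\<in>G k. c j * \<Phi> j x)) \<and>
     (\<Sum>j\<in>G n. (c j)\<^sup>2) \<noteq> 0}"

text \<open>
  The supremum is taken in the extended reals, so that it needs no boundedness assumption.
  The quantity is meant for \<open>n \<ge> 1\<close> and orthogonal systems \<open>\<Phi>\<close> of nonzero functions in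
  \<open>L\<^sup>2\<close>, for which the denominators are positive.
\<close>

definition maximal_constant :: "nat \<Rightarrow> (nat \<Rightarrow> real \<Rightarrow> real) \<Rightarrow> ereal" where
  "maximal_constant n \<Phi> =
     (SUP p\<in>monotonic_polynomials \<Phi> n.
        ereal (L2_norm (\<lambda>x. MAX m\<in>{1..n}. \<bar>p m x\<bar>) / L2_norm (p n)))"

end

theory Submission
  imports Defs
begin

text \<open>
  Upper bound. Let \<open>X\<close> be one of the polynomials \<open>p\<^sub>m\<close>, viewed as a martingale, and let \<open>Q\<close> be
  \<open>\<parallel>p\<^sub>n\<parallel>\<^sup>2\<close> plus a multiple of the sum of the square function and the conditional square
  function of \<open>p\<^sub>n\<close>; since the spectra are nested, \<open>Q\<close> does not depend on \<open>m\<close>. A pointwise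
  inequality shows that \<open>Q exp (X\<^sup>2 / Q)\<close> is a supermartingale up to an error controlled by the
  increments of \<open>Q\<close>, so its integral is \<open>O(\<parallel>p\<^sub>n\<parallel>\<^sup>2)\<close> even though the splits are arbitrarily
  unbalanced. From \<open>X\<^sup>2 \<le> Q ln n + Q exp (X\<^sup>2 / Q) / n\<close>, summed over the \<open>n\<close> polynomials in the
  error term only, the maximal function has square norm \<open>O(log n) \<parallel>p\<^sub>n\<parallel>\<^sup>2\<close>.

  Lower bound. Consecutive blocks of the system contain polynomials \<open>g\<^sub>0, \<dots>, g\<^bsub>r-1\<^esub>\<close> with
  \<open>\<bar>g\<^sub>l\<bar> \<le> 1\<close> whose positive parts have integral at least \<open>2/9\<close>. The signs of the \<open>g\<^sub>l\<close> form a
  binary tree of depth \<open>r\<close>; adding the pieces of the \<open>g\<^sub>l\<close> in the in-order of its nodes, each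
  point \<open>x\<close> sees, at some moment, exactly the sum of the positive parts. This takes fewer than
  \<open>2\<^sup>r\<close> steps, the maximal function has norm of order \<open>r\<close>, and the full sum has norm at most
  \<open>sqrt r\<close>.
\<close>

section \<open>A self-normalized exponential inequality\<close>

lemma exp_le_quadratic:
  fixes u :: real assumes "u \<le> 1" shows "exp u \<le> 1 + u + u\<^sup>2"
proof (cases "u \<ge> 0")
  case True then show ?thesis using exp_bound assms by blast
next
  case False
  define t where "t = - u"
  have t: "t > 0" using False t_def by simp
  have "1 + t + t\<^sup>2 / 2 \<le> exp t" using exp_lower_Taylor_quadratic t by simp
  moreover have p: "1 - t + t\<^sup>2 \<ge> 0"
    using t zero_le_power2[of "t - 1"] by (simp add: power2_eq_square algebra_simps)
  ultimately have "(1 - t + t\<^sup>2) * (1 + t + t\<^sup>2 / 2) \<le> (1 - t + t\<^sup>2) * exp t"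
    by (intro mult_left_mono) auto
  moreover have "(1 - t + t\<^sup>2) * (1 + t + t\<^sup>2 / 2) = 1 + t^2/2 + t^3/2 + t^4/2"
    by (simp add: field_simps eval_nat_numeral)
  moreover have "1 \<le> 1 + t^2/2 + t^3/2 + t^4/2" using t by simp
  ultimately have "1 \<le> (1 - t + t\<^sup>2) * exp t" by linarith
  then show ?thesis unfolding t_def by (simp add: exp_minus field_simps)
qed

lemma exp_le_quadratic':
  fixes u b :: real assumes "u \<le> b" "b \<ge> 0" shows "exp u \<le> 1 + u + u\<^sup>2 * exp b"
proof (cases "u \<le> 1")
  case True
  have "u\<^sup>2 * 1 \<le> u\<^sup>2 * exp b" using assms by (intro mult_left_mono) auto
  then show ?thesis using exp_le_quadratic[OF True] by simp
next
  case False
  have "1 \<le> u\<^sup>2" using False by simp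
  then have "1 * exp b \<le> u\<^sup>2 * exp b" by (intro mult_right_mono) auto
  then show ?thesis using False assms exp_le_cancel_iff[of u b] by linarith
qed

text \<open>The correction -y^2/2 makes a quadratic majorant possible for all real y, so that the
  mean of the right-hand side over a centred increment involves only its second moment. On [0,4] the
  slack is y^3 (4 - y) / 4, which fixes the threshold 4; above it the left side is at most 1. For
  negative y the two sides are compared after multiplication by exp (-y + y^2/2).\<close>

lemma exp_gaussian_le:
  fixes y :: real shows "exp (y - y\<^sup>2/2) \<le> 1 + y + y\<^sup>2/2"
proof -
  consider "y < 0" | "0 \<le> y" "y \<le> 4" | "y > 4" by linarith
  then show ?thesis
  proof cases
    case 1
    define t where "t = - y"
    have t: "t > 0" using 1 t_def by simp
    define v where "v = t + t\<^sup>2/2"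
    have "v \<ge> 0" using t v_def by simp
    then have "1 + v + v\<^sup>2 / 2 \<le> exp v" using exp_lower_Taylor_quadratic by simp
    moreover have "1 - t + t\<^sup>2/2 \<ge> 0"
      using zero_le_power2[of "t - 1"] by (simp add: power2_eq_square algebra_simps)
    ultimately have "(1 - t + t\<^sup>2/2) * (1 + v + v\<^sup>2 / 2) \<le> (1 - t + t\<^sup>2/2) * exp v"
      by (intro mult_left_mono) auto
    moreover have "(1 - t + t\<^sup>2/2) * (1 + v + v\<^sup>2 / 2) = 1 + t^2/2 + t^4/8 + t^5/8 + t^6/16"
      unfolding v_def by (simp add: field_simps eval_nat_numeral)
    moreover have "1 \<le> 1 + t^2/2 + t^4/8 + t^5/8 + t^6/16" using t by simp
    ultimately have "1 \<le> (1 - t + t\<^sup>2/2) * exp v" by linarith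
    moreover have "exp (y - y\<^sup>2/2) = 1 / exp v"
      by (simp add: v_def t_def exp_minus[symmetric] field_simps flip: exp_minus exp_add)
    ultimately show ?thesis by (simp add: t_def pos_divide_le_eq)
  next
    case 2
    have "y - y\<^sup>2/2 \<le> 1"
      using zero_le_power2[of "y - 1"] by (simp add: power2_eq_square algebra_simps)
    then have "exp (y - y\<^sup>2/2) \<le> 1 + (y - y\<^sup>2/2) + (y - y\<^sup>2/2)\<^sup>2" by (rule exp_le_quadratic)
    also have "\<dots> = 1 + y + y\<^sup>2/2 - y^3 * (4 - y)/4"
      by (simp add: field_simps eval_nat_numeral)
    also have "\<dots> \<le> 1 + y + y\<^sup>2/2" using 2 by simp
    finally show ?thesis .
  next
    case 3
    have "y - y\<^sup>2/2 = y * (2 - y)/2" by (simp add: field_simps power2_eq_square)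
    also have "\<dots> \<le> 0" using 3 by (simp add: mult_nonneg_nonpos)
    finally have "exp (y - y\<^sup>2/2) \<le> 1" by simp
    then show ?thesis using 3 zero_le_power2[of y] by linarith
  qed
qed

section \<open>One step of the supermartingale\<close>

text \<open>The size is dictated by the bounded regime \<open>x\<^sup>2 < 128\<close>,
  \<open>s \<le> 3\<close> of the next lemma; the other regimes cost at most 2 exp 65 times
  s.\<close>

definition self_normalized_const :: real where
  "self_normalized_const = exp 128 * (266 + 56 * exp 13)"

text \<open>
  If \<open>d\<close> is random with mean \<open>0\<close> and second moment \<open>v\<close>, the factor multiplying \<open>exp (x\<^sup>2)\<close> has
  mean \<open>1\<close>.
\<close>

lemma self_normalized_step_unit:
  fixes x d v s :: real
  assumes v: "v \<ge> 0" and s: "32 * (d\<^sup>2 + v) \<le> s"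
  shows "(1 + s) * exp ((x + d)\<^sup>2 / (1 + s)) \<le>
    exp (x\<^sup>2) * (1 + 2*x*d + (2*x*d)\<^sup>2/2) / (1 + 2 * x\<^sup>2 * v) + self_normalized_const * s"
    (is "?L \<le> ?R + _")
proof -
  define W where "W = x\<^sup>2"
  define y where "y = 2*x*d"
  define g where "g = 1 + y + y\<^sup>2/2"
  have W0: "W \<ge> 0" by (simp add: W_def)
  have ds: "d\<^sup>2 \<le> s/32" using v s by (simp add: distrib_left)
  have vs: "v \<le> s/32" using order_trans[OF _ s, of "32 * v"] by simp
  then have s0: "s \<ge> 0" using v by linarith
  have g: "g \<ge> 1/2"
    unfolding g_def using zero_le_power2[of "y + 1"] by (simp add: power2_eq_square algebra_simps)
  have kap: "1 + 2*W * v \<ge> 1" using v W0 by simp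
  have R: "?R = exp W * g / (1 + 2*W * v)" by (simp add: W_def g_def y_def)
  have R0: "?R \<ge> 0" unfolding R using g kap by simp
  have y2: "y\<^sup>2 = 4 * W * d\<^sup>2" by (simp add: y_def W_def power_mult_distrib)
  have C: "self_normalized_const \<ge> exp 128 * 266" by (simp add: self_normalized_const_def)
  have C': "self_normalized_const \<ge> 2 * exp 65"
  proof -
    have "(exp 65::real) \<le> exp 128" by simp
    then show ?thesis using C exp_gt_zero[of "128::real"] by linarith
  qed
  have crude: "(x + d)\<^sup>2 / (1 + s) \<le> 2 * W / (1 + s) + 1"
  proof -
    have "(x + d)\<^sup>2 \<le> 2 * W + 2 * d\<^sup>2"
      unfolding W_def using zero_le_power2[of "x - d"] by (simp add: power2_eq_square algebra_simps)
    also have "\<dots> \<le> 2 * W + (1 + s)" using ds s0 by linarith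
    finally have "(x + d)\<^sup>2 / (1 + s) \<le> (2 * W + (1 + s)) / (1 + s)"
      using s0 by (intro divide_right_mono) auto
    also have "\<dots> = 2 * W / (1 + s) + 1" using s0 by (simp add: field_simps)
    finally show ?thesis .
  qed
  \<comment> \<open>With s > 3 and W at most comparable to s, the left side is itself O(s).\<close>
  have big: "?L \<le> self_normalized_const * s" if "s > 3" and "2 * W / (1 + s) \<le> 64"
  proof -
    have "(x + d)\<^sup>2 / (1 + s) \<le> 65" using crude that by linarith
    then have "?L \<le> (1 + s) * exp 65" using s0 by (intro mult_left_mono) auto
    also have "\<dots> \<le> (2 * s) * exp 65" using that by (intro mult_right_mono) auto
    also have "\<dots> = (2 * exp 65) * s" by simp
    also have "\<dots> \<le> self_normalized_const * s" using C' s0 by (intro mult_right_mono) auto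
    finally show ?thesis .
  qed
  \<comment> \<open>Enlarging the denominator from 1 to 1 + s gains W s / 8 in the exponent, as s /
    (1 + s) >= s / 4 for s <= 3. The terms in d^2 and the prefactor 1 + s <= exp s cost at most 2 s
    together.\<close>
  have small: "?L \<le> exp (W + y + 2 * s - W * s / 8)" if "s \<le> 3"
  proof -
    have "(x + d)\<^sup>2 \<ge> W/2 - d\<^sup>2"
      unfolding W_def using zero_le_power2[of "x + 2 * d"] by (simp add: power2_eq_square algebra_simps)
    then have "s / (1 + s) * (W/2 - d\<^sup>2) \<le> s / (1 + s) * (x + d)\<^sup>2"
      using s0 by (intro mult_left_mono) auto
    moreover have "(x + d)\<^sup>2 / (1 + s) = W + y + d\<^sup>2 - s / (1 + s) * (x + d)\<^sup>2"
      using s0 unfolding W_def y_def by (simp add: field_simps power2_eq_square)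
    ultimately have 1: "(x + d)\<^sup>2 / (1 + s) \<le> W + y + d\<^sup>2 - s / (1 + s) * (W/2 - d\<^sup>2)" by linarith
    have 2: "s / (1 + s) * d\<^sup>2 \<le> 1 * d\<^sup>2" using s0 by (intro mult_right_mono) auto
    have 3: "(s / 4) * (W / 2) \<le> s / (1 + s) * (W / 2)"
      using s0 that W0 by (intro mult_right_mono divide_left_mono) auto
    have "(x + d)\<^sup>2 / (1 + s) \<le> W + y + 2 * d\<^sup>2 - s * W / 8"
      using 1 2 3 by (simp add: right_diff_distrib)
    then have "(x + d)\<^sup>2 / (1 + s) \<le> W + y + s - W * s / 8" using ds s0 by (simp add: mult.commute)
    then have "?L \<le> exp s * exp (W + y + s - W * s / 8)"
      using s0 exp_ge_add_one_self[of s] by (intro mult_mono) auto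
    also have "\<dots> = exp (W + y + 2 * s - W * s / 8)" by (simp flip: exp_add add: algebra_simps)
    finally show ?thesis .
  qed
  \<comment> \<open>For large x^2 the exponent itself gains enough (A, C) and no error term is
    spent. The error term pays when x^2 is at most comparable to s (B) or when everything is bounded
    (D).\<close>
  consider (A) "W \<ge> 128" "s \<le> 3" | (B) "s > 3" "2 * W \<le> 64 * (1 + s)"
    | (C) "s > 3" "2 * W > 64 * (1 + s)" | (D) "W < 128" "s \<le> 3"
    by fastforce
  then show ?thesis
  proof cases
    case A
    \<comment> \<open>Half of W s / 8 outweighs 2 s because W >= 128; the other half pays for y^2/2
      + 2 W v = 2 W (d^2 + v), which is where the factor 32 of the hypothesis enters.\<close>
    have "128 * s \<le> W * s" using A s0 by (intro mult_right_mono) auto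
    moreover have "W * (32 * (d\<^sup>2 + v)) \<le> W * s" using W0 s by (intro mult_left_mono) auto
    ultimately have "2 * s - W * s / 8 \<le> - (2 * W * (d\<^sup>2 + v))" using s0 by (simp add: algebra_simps)
    then have "W + y + 2 * s - W * s / 8 \<le> W + (y - y\<^sup>2/2) - 2*W * v"
      unfolding y2 by (simp add: algebra_simps)
    then have "?L \<le> exp (W + (y - y\<^sup>2/2) - 2*W * v)" using small[OF A(2)]
      by (meson exp_le_cancel_iff order_trans)
    also have "\<dots> = exp W * exp (y - y\<^sup>2/2) / exp (2*W * v)" by (simp add: exp_add exp_diff)
    also have "\<dots> \<le> exp W * g / (1 + 2*W * v)"
      using kap g exp_gaussian_le[of y] exp_ge_add_one_self[of "2*W* v"]
      by (intro frac_le mult_left_mono mult_nonneg_nonneg) (auto simp: g_def)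
    finally have "?L \<le> ?R" unfolding R .
    moreover have "0 \<le> self_normalized_const * s" using s0 C' by (intro mult_nonneg_nonneg) (auto intro: order_trans[rotated])
    ultimately show ?thesis by linarith
  next
    case B
    have "2 * W / (1 + s) \<le> 64" using B s0 by (simp add: field_simps)
    then show ?thesis using big B R0 by linarith
  next
    case C
    then have W: "W \<ge> 128" and s1: "1 + s \<le> W" by simp_all
    \<comment> \<open>Since 1 + s > 4, about half of the exponent W is left over, and exp (W/2)
      absorbs the polynomial factors.\<close>
    have "2 * W / (1 + s) \<le> 2 * W / 4" using C W0 by (intro divide_left_mono) auto
    then have "(x + d)\<^sup>2 / (1 + s) \<le> W / 2 + 1" using crude by linarith
    then have "?L \<le> W * exp (W / 2 + 1)" using s1 s0 by (intro mult_mono) auto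
    also have "\<dots> \<le> W * (exp (W/2) * 3)"
      using W0 exp_le by (simp add: exp_add mult_left_mono)
    also have "\<dots> = (3 * W) * exp (W/2)" by simp
    also have "\<dots> \<le> exp W * g / (1 + 2*W * v)"
    proof -
      have "2 * W * v \<le> 2 * W * (W / 32)" using vs s1 W0 by (intro mult_left_mono) auto
      then have "1 + 2 * W * v \<le> 1 + W\<^sup>2 / 16" by (simp add: power2_eq_square)
      also have "\<dots> \<le> W\<^sup>2 / 8"
        using mult_mono[OF W W] W by (simp add: power2_eq_square)
      finally have "3 * W * (1 + 2*W * v) * 2 \<le> 3 * W * (W\<^sup>2/8) * 2"
        using W0 by (intro mult_right_mono mult_left_mono) auto
      also have "\<dots> \<le> W^3 * 1" using W0 by (simp add: power2_eq_square power3_eq_cube)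
      \<comment> \<open>A factor of at least 1 is inserted so that the product becomes the eighth
        power (W/16)^8, to which (1 + t/n)^n <= exp t applies.\<close>
      also have "\<dots> \<le> W^3 * ((W/128)^5 * 8)"
      proof -
        have "1 \<le> (W/128)^5" using W by (intro one_le_power) auto
        then show ?thesis using W0 by (intro mult_left_mono) auto
      qed
      also have "\<dots> = (W/16)^8" by (simp add: power_divide eval_nat_numeral)
      also have "\<dots> \<le> (1 + (W/2)/real 8)^8" using W0 by (intro power_mono) auto
      also have "\<dots> \<le> exp (W/2)" using W0 by (intro exp_ge_one_plus_x_over_n_power_n) auto
      finally have *: "3 * W * (1 + 2*W * v) \<le> exp (W/2) * (1/2)" by simp
      also have "\<dots> \<le> exp (W/2) * g" using g by (intro mult_left_mono) auto
      finally have "exp (W/2) * (3 * W * (1 + 2*W * v)) \<le> exp (W/2) * (exp (W/2) * g)"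
        by (intro mult_left_mono) auto
      also have "\<dots> = exp W * g" by (simp flip: exp_add mult.assoc)
      finally show ?thesis using kap by (simp add: field_simps)
    qed
    finally have "?L \<le> ?R" unfolding R .
    moreover have "0 \<le> self_normalized_const * s" using s0 C' by (intro mult_nonneg_nonneg) (auto intro: order_trans[rotated])
    ultimately show ?thesis by linarith
  next
    case D
    \<comment> \<open>Everything is bounded here, so the second-order remainder of exp u is of order
      s: y^2 <= 16 s <= 48 < 7^2 and u <= 7 + 6 = 13.\<close>
    have "4 * W * d\<^sup>2 \<le> 4 * 128 * (s/32)" using D W0 ds s0 by (intro mult_mono) auto
    then have y2s: "y\<^sup>2 \<le> 16 * s" unfolding y2 by simp
    then have y49: "y\<^sup>2 \<le> 49" using D by simp
    then have "y\<^sup>2 \<le> 7\<^sup>2" by simp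
    then have y7: "\<bar>y\<bar> \<le> 7" by (metis abs_le_square_iff abs_numeral)
    define u where "u = y + 2 * s"
    have u: "u \<le> 13" using y7 D by (simp add: u_def)
    have "u\<^sup>2 \<le> 2 * y\<^sup>2 + 8 * s\<^sup>2" unfolding u_def using zero_le_power2[of "y - 2* s"]
      by (simp add: power2_eq_square algebra_simps)
    also have "\<dots> \<le> 56 * s"
      using y2s mult_right_mono[OF D(2) s0] by (simp add: power2_eq_square)
    finally have u2: "u\<^sup>2 \<le> 56 * s" .
    have "W + y + 2 * s - W * s / 8 \<le> W + u" using W0 s0 by (simp add: u_def)
    then have "?L \<le> exp (W + u)" using small[OF D(2)] by (meson exp_le_cancel_iff order_trans)
    also have "\<dots> = exp W * exp u" by (simp add: exp_add)
    also have "\<dots> \<le> exp W * (1 + u + u\<^sup>2 * exp 13)"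
      using exp_le_quadratic'[OF u] by (intro mult_left_mono) auto
    also have "\<dots> \<le> exp W * (1 + u + 56 * s * exp 13)"
      using u2 by (intro mult_left_mono add_left_mono mult_right_mono) auto
    also have "\<dots> \<le> exp W * (g / (1 + 2*W * v) + (266 + 56 * exp 13) * s)"
    proof (intro mult_left_mono)
      have "2 * W * v \<le> 2 * 128 * (s / 32)" using D W0 vs v by (intro mult_mono) auto
      then have k: "2 * W * v \<le> 8 * s" by simp
      have g32: "g \<le> 33" using y7 y49 unfolding g_def by linarith
      \<comment> \<open>Replacing g / (1 + 2 W v) by g costs at most 33 * 8 s = 264 s; the remaining
        2 s of the constant 266 comes from u = y + 2 s.\<close>
      have "g - g / (1 + 2*W * v) = g / (1 + 2*W * v) * (2*W * v)" using kap by (simp add: field_simps)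
      also have "\<dots> \<le> g * (2*W * v)"
        using g W0 v kap less_le_trans[OF zero_less_one kap] divide_left_mono[of 1 "1 + 2*W * v" g]
        by (intro mult_right_mono) simp_all
      also have "\<dots> \<le> 33 * (8 * s)" using g W0 v by (intro mult_mono[OF g32 k]) auto
      finally have "1 + y \<le> g / (1 + 2*W * v) + 264 * s"
        unfolding g_def using zero_le_power2[of y] by linarith
      then show "1 + u + 56 * s * exp 13 \<le> g / (1 + 2*W * v) + (266 + 56 * exp 13) * s"
        unfolding u_def by (simp add: algebra_simps)
    qed auto
    also have "\<dots> = ?R + exp W * (266 + 56 * exp 13) * s" unfolding R by (simp add: algebra_simps)
    also have "\<dots> \<le> ?R + self_normalized_const * s"
      unfolding self_normalized_const_def using D s0
      by (intro add_left_mono mult_right_mono) auto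
    finally show ?thesis .
  qed
qed

text \<open>The prefactor makes the weight scale like x^2: for nonzero t, \<open>gauss_weight (t *
  x) (t\<^sup>2 * q) = t\<^sup>2 * gauss_weight x q\<close>.\<close>

definition gauss_weight :: "real \<Rightarrow> real \<Rightarrow> real" where
  "gauss_weight x q = q * exp (x\<^sup>2 / q)"

text \<open>By scaling, the case q = 1 is applied to x and d divided by \<open>sqrt q\<close> and to
  v and s divided by q.\<close>

lemma self_normalized_step:
  fixes x d v s q :: real
  assumes q: "q > 0" and v: "v \<ge> 0" and s: "32 * (d\<^sup>2 + v) \<le> s"
  shows "gauss_weight (x + d) (q + s) \<le>
    gauss_weight x q * (1 + 2*x*d/q + 2*x\<^sup>2*d\<^sup>2/q\<^sup>2) / (1 + 2*x\<^sup>2 * v/q\<^sup>2)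
      + self_normalized_const * s"
proof -
  define r where "r = sqrt q"
  have r: "r > 0" "q = r\<^sup>2" using q by (auto simp: r_def)
  have "32 * ((d/r)\<^sup>2 + v/q) \<le> s/q" using divide_right_mono[OF s, of q] q
    by (simp add: r(2) power_divide add_divide_distrib distrib_left)
  then have "(1 + s/q) * exp ((x/r + d/r)\<^sup>2 / (1 + s/q)) \<le>
    exp ((x/r)\<^sup>2) * (1 + 2*(x/r)*(d/r) + (2*(x/r)*(d/r))\<^sup>2/2) / (1 + 2 * (x/r)\<^sup>2 * (v/q)) + self_normalized_const * (s/q)"
    by (intro self_normalized_step_unit) (use v q in auto)
  then have "q * ((1 + s/q) * exp ((x/r + d/r)\<^sup>2 / (1 + s/q))) \<le>
    q * (exp ((x/r)\<^sup>2) * (1 + 2*(x/r)*(d/r) + (2*(x/r)*(d/r))\<^sup>2/2) / (1 + 2 * (x/r)\<^sup>2 * (v/q)) + self_normalized_const * (s/q))"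
    using q by (intro mult_left_mono) auto
  moreover have "(x/r + d/r)\<^sup>2 / (1 + s/q) = (x+d)\<^sup>2/(q+s)"
  proof -
    have "(x/r + d/r)\<^sup>2 = (x+d)\<^sup>2/q" by (simp add: r(2) power_divide flip: add_divide_distrib)
    moreover have "1 + s/q = (q+s)/q" using q by (simp add: field_simps)
    ultimately show ?thesis using q by simp
  qed
  moreover have "q * ((1 + s/q) * e) = (q + s) * e" for e using q by (simp add: field_simps)
  moreover have "(x/r)\<^sup>2 = x\<^sup>2/q" by (simp add: r(2) power_divide)
  moreover have "2*(x/r)*(d/r) = 2*x*d/q" by (simp add: r(2) power2_eq_square)
  moreover have "2 * (x\<^sup>2/q) * (v/q) = 2*x\<^sup>2 * v/q\<^sup>2" by (simp add: power2_eq_square)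
  moreover have "(2*x*d/q)\<^sup>2/2 = 2*x\<^sup>2*d\<^sup>2/q\<^sup>2" by (simp add: power_divide power_mult_distrib)
  moreover have "q * (e * g / k + self_normalized_const * (s/q)) = q * e * g / k + self_normalized_const * s" for e g k
    using q by (simp add: field_simps)
  ultimately show ?thesis unfolding gauss_weight_def by (simp only:)
qed

text \<open>This is ln z <= z - 1 at z = exp (x^2/q) / n. In the application q is common to all n
  polynomials: the first term needs no sum over them, and the sum of the second is divided by
  n.\<close>

lemma square_le_ln_gauss_weight:
  fixes x q :: real
  assumes q: "q > 0" and n: "n > 0"
  shows "x\<^sup>2 \<le> q * ln n + gauss_weight x q / n"
proof -
  have "ln (exp (x\<^sup>2 / q) / n) \<le> exp (x\<^sup>2 / q) / n - 1" using n by (intro ln_le_minus_one) simp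
  moreover have "ln (exp (x\<^sup>2 / q) / n) = x\<^sup>2 / q - ln n" using n by (simp add: ln_div)
  ultimately have "x\<^sup>2 / q \<le> ln n + exp (x\<^sup>2 / q) / n" by simp
  then have "q * (x\<^sup>2 / q) \<le> q * (ln n + exp (x\<^sup>2 / q) / n)" using q by (intro mult_left_mono) auto
  then show ?thesis using q by (simp add: gauss_weight_def distrib_left)
qed

section \<open>Generalized Haar systems\<close>

lemma set_integral_unit_lebesgue:
  fixes f g :: "real \<Rightarrow> real"
  assumes "A \<subseteq> {0..<1}" "\<And>x. x \<in> {0..<1} \<Longrightarrow> f x = indicator A x * g x"
  shows "(\<integral>x. f x \<partial>unit_lebesgue) = (LINT x:A|lebesgue. g x)"
proof -
  have "(\<integral>x. f x \<partial>unit_lebesgue) = (\<integral>x. indicator {0..<1} x *\<^sub>R f x \<partial>lebesgue)"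
    by (simp add: integral_restrict_space)
  also have "\<dots> = (LINT x:A|lebesgue. g x)"
    unfolding set_lebesgue_integral_def using assms
    by (intro Bochner_Integration.integral_cong) (auto simp: indicator_def)
  finally show ?thesis .
qed

lemma set_integral_const_interval:
  fixes a b c :: real
  assumes "a \<le> b" shows "(LINT x:{a..<b}|lebesgue. c) = (b - a) * c"
  using assms by (simp add: set_lebesgue_integral_def)

lemma integral_indicator_interval:
  fixes a b c :: real
  assumes "a \<le> b" "{a..<b} \<subseteq> {0..<1}"
  shows "(\<integral>x. indicator {a..<b} x * c \<partial>unit_lebesgue) = (b - a) * c"
proof -
  have "(\<integral>x. indicator {a..<b} x * c \<partial>unit_lebesgue) = (LINT x:{a..<b}|lebesgue. c)"
    using assms by (intro set_integral_unit_lebesgue) auto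
  then show ?thesis using assms by (simp add: set_integral_const_interval)
qed

text \<open>Skolem form of the definition: step n splits [\<alpha> n, \<beta> n) at \<gamma> n, and
  the function created by this split is \<open>h (Suc n)\<close>, hence the index shift in
  \<open>mean_0\<close>.\<close>

locale haar_system =
  fixes \<A> :: "nat \<Rightarrow> real set set" and h :: "nat \<Rightarrow> real \<Rightarrow> real" and \<alpha> \<gamma> \<beta> :: "nat \<Rightarrow> real"
  assumes partition: "n \<ge> 1 \<Longrightarrow> unit_partition (\<A> n)"
    and atoms_1: "\<A> 1 = {{0..<1}}"
    and split_less: "n \<ge> 1 \<Longrightarrow> \<alpha> n < \<gamma> n" "n \<ge> 1 \<Longrightarrow> \<gamma> n < \<beta> n"
    and split_atom: "n \<ge> 1 \<Longrightarrow> {\<alpha> n..<\<beta> n} \<in> \<A> n"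
    and atoms_Suc: "n \<ge> 1 \<Longrightarrow>
      \<A> (Suc n) = (\<A> n - {{\<alpha> n..<\<beta> n}}) \<union> {{\<alpha> n..<\<gamma> n}, {\<gamma> n..<\<beta> n}}"
    and mesh: "(\<lambda>n. MAX A\<in>\<A> n. measure lebesgue A) \<longlonglongrightarrow> 0"
    and const: "n \<ge> 1 \<Longrightarrow> A \<in> \<A> n \<Longrightarrow> h n constant_on A"
    and mean_0: "n \<ge> 1 \<Longrightarrow> A \<in> \<A> n \<Longrightarrow> (LINT x:A|lebesgue. h (Suc n) x) = 0"
    and norm_1: "n \<ge> 1 \<Longrightarrow> L2_norm (h n) = 1"

lemma generalized_haar_system_locale:
  assumes "generalized_haar_system h"
  obtains \<A> \<alpha> \<gamma> \<beta> where "haar_system \<A> h \<alpha> \<gamma> \<beta>"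
proof -
  obtain \<A> where A: "haar_filtration \<A>" "martingale_difference \<A> h" "\<forall>n\<ge>1. L2_norm (h n) = 1"
    using assms unfolding generalized_haar_system_def by blast
  define P where "P n a c b \<longleftrightarrow> a < c \<and> c < b \<and> {a..<b} \<in> \<A> n \<and>
        \<A> (Suc n) = (\<A> n - {{a..<b}}) \<union> {{a..<c}, {c..<b}}" for n and a c b :: real
  have "\<forall>n\<ge>1. \<exists>a c b. P n a c b"
    using A(1) unfolding haar_filtration_def P_def by (elim conjE) assumption
  then obtain \<alpha> \<gamma> \<beta> where s: "\<And>n. n \<ge> 1 \<Longrightarrow> P n (\<alpha> n) (\<gamma> n) (\<beta> n)"
    by metis
  have f: "filtration \<A>" and a1: "\<A> 1 = {{0..<1}}" and m: "(\<lambda>n. MAX A\<in>\<A> n. measure lebesgue A) \<longlonglongrightarrow> 0"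
    using A(1) unfolding haar_filtration_def by blast+
  have c: "\<forall>n\<ge>1. \<forall>A\<in>\<A> n. h n constant_on A"
    and m0: "\<forall>n\<ge>2. \<forall>A\<in>\<A> (n - 1). (LINT x:A|lebesgue. h n x) = 0"
    using A(2) unfolding martingale_difference_def by blast+
  have "haar_system \<A> h \<alpha> \<gamma> \<beta>"
  proof
    fix n A assume "n \<ge> (1::nat)" "A \<in> \<A> n"
    then show "(LINT x:A|lebesgue. h (Suc n) x) = 0"
      using m0[rule_format, of "Suc n" A] by simp
  next
    fix n :: nat assume n: "n \<ge> 1"
    show "unit_partition (\<A> n)" using f n unfolding filtration_def by blast
    show "\<alpha> n < \<gamma> n" "\<gamma> n < \<beta> n" "{\<alpha> n..<\<beta> n} \<in> \<A> n"
      "\<A> (Suc n) = (\<A> n - {{\<alpha> n..<\<beta> n}}) \<union> {{\<alpha> n..<\<gamma> n}, {\<gamma> n..<\<beta> n}}"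
      using s[OF n] unfolding P_def by - (elim conjE, assumption)+
    show "L2_norm (h n) = 1" using A(3) n by blast
    show "h n constant_on A" if "A \<in> \<A> n" for A using c n that by blast
  qed (fact a1 m)+
  then show ?thesis by (rule that)
qed

section \<open>Atoms and step functions\<close>

context haar_system
begin

text \<open>Measurability with respect to the partition \<open>\<A> n\<close>. The value type is
  free because the integer addresses of the lower bound are step functions too.\<close>

definition step_fun :: "nat \<Rightarrow> (real \<Rightarrow> 'b) \<Rightarrow> bool" where
  "step_fun n f \<longleftrightarrow> (\<forall>A\<in>\<A> n. f constant_on A)"

text \<open>The conditional expectation of \<open>(h (Suc n))\<^sup>2\<close> with respect to \<open>\<A> n\<close>.\<close>

definition split_density :: "nat \<Rightarrow> real \<Rightarrow> real" where
  "split_density n x = indicator {\<alpha> n..<\<beta> n} x / (\<beta> n - \<alpha> n)"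

lemma atom_subset: "n \<ge> 1 \<Longrightarrow> A \<in> \<A> n \<Longrightarrow> A \<subseteq> {0..<1}"
  using partition unfolding unit_partition_def by blast

lemma atom_cover: "n \<ge> 1 \<Longrightarrow> x \<in> {0..<1} \<Longrightarrow> \<exists>A\<in>\<A> n. x \<in> A"
  using partition unfolding unit_partition_def by blast

lemma atom_unique: "n \<ge> 1 \<Longrightarrow> A \<in> \<A> n \<Longrightarrow> B \<in> \<A> n \<Longrightarrow> x \<in> A \<Longrightarrow> x \<in> B \<Longrightarrow> A = B"
  using partition unfolding unit_partition_def disjoint_def by blast

lemma finite_atoms: "n \<ge> 1 \<Longrightarrow> finite (\<A> n)"
  by (induction n rule: nat_induct_at_least) (use atoms_1 in \<open>simp_all add: atoms_Suc\<close>)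

lemma atom_interval: "n \<ge> 1 \<Longrightarrow> A \<in> \<A> n \<Longrightarrow> \<exists>a b. a < b \<and> A = {a..<b}"
proof (induction n arbitrary: A rule: nat_induct_at_least)
  case base
  then have "A = {0..<1}" using atoms_1 by simp
  then show ?case by (intro exI[of _ 0] exI[of _ 1]) simp
next
  case (Suc n)
  then show ?case using split_less[of n] by (auto simp: atoms_Suc)
qed

lemma atom_parent:
  assumes n: "n \<ge> 1" and A: "A \<in> \<A> (Suc n)" shows "\<exists>B\<in>\<A> n. A \<subseteq> B"
proof (cases "A \<in> \<A> n")
  case False
  then have "A \<subseteq> {\<alpha> n..<\<beta> n}" using A split_less[OF n] by (auto simp: atoms_Suc[OF n])
  then show ?thesis using split_atom[OF n] by blast
qed blast

lemma step_fun_Suc: "n \<ge> 1 \<Longrightarrow> step_fun n f \<Longrightarrow> step_fun (Suc n) f"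
  unfolding step_fun_def by (meson atom_parent constant_on_subset)

lemma step_fun_mono:
  assumes "n \<le> n'" "n \<ge> 1" "step_fun n f" shows "step_fun n' f"
  using assms by (induction n' rule: dec_induct) (auto intro: step_fun_Suc)

lemma step_fun_h: "1 \<le> m \<Longrightarrow> m \<le> n \<Longrightarrow> step_fun n (h m)"
  by (rule step_fun_mono[of m]) (auto simp: step_fun_def const)

lemma step_fun_const: "step_fun n (\<lambda>x. c)"
  by (auto simp: step_fun_def constant_on_def)

lemma step_fun_compose: "step_fun n f \<Longrightarrow> step_fun n (\<lambda>x. \<phi> (f x))"
  unfolding step_fun_def constant_on_def by metis

lemma step_fun_compose2: "step_fun n f \<Longrightarrow> step_fun n g \<Longrightarrow> step_fun n (\<lambda>x. \<phi> (f x) (g x))"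
  unfolding step_fun_def constant_on_def by metis

lemmas step_fun_add = step_fun_compose2[where \<phi> = "(+)"]
  and step_fun_mult = step_fun_compose2[where \<phi> = "(*)"]
  and step_fun_power = step_fun_compose[where \<phi> = "\<lambda>x. x ^ k" for k]

lemma step_fun_sum:
  assumes "\<And>i. i \<in> I \<Longrightarrow> step_fun n (f i)"
  shows "step_fun n (\<lambda>x. \<Sum>i\<in>I. f i x :: real)"
  using assms
  by (induction I rule: infinite_finite_induct)
    (simp_all add: step_fun_const step_fun_add)

lemma step_fun_split_density: 
  assumes "n \<ge> 1" shows "step_fun n (split_density n)"
  unfolding step_fun_def
proof
  fix A assume A: "A \<in> \<A> n"
  show "split_density n constant_on A"
  proof (cases "A = {\<alpha> n..<\<beta> n}")
    case True
    then show ?thesis by (auto simp: constant_on_def split_density_def)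
  next
    case False
    then have "x \<notin> {\<alpha> n..<\<beta> n}" if "x \<in> A" for x
      using A that split_atom[OF assms] atom_unique[OF assms] by blast
    then show ?thesis unfolding constant_on_def split_density_def
      by (intro exI[of _ 0]) (simp add: indicator_def)
  qed
qed

lemma sets_atom: "n \<ge> 1 \<Longrightarrow> A \<in> \<A> n \<Longrightarrow> A \<in> sets unit_lebesgue"
  using atom_interval[of n A] atom_subset[of n A] by (auto simp: sets_restrict_space_iff)

lemma step_fun_integrable:
  fixes f :: "real \<Rightarrow> real"
  assumes n: "n \<ge> 1" and f: "step_fun n f"
  shows "integrable unit_lebesgue f"
proof -
  obtain c where c: "\<And>A x. A \<in> \<A> n \<Longrightarrow> x \<in> A \<Longrightarrow> f x = c A"
    using f unfolding step_fun_def constant_on_def by metis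
  have "f x = (\<Sum>A\<in>\<A> n. c A * indicator A x)" if x: "x \<in> {0..<1}" for x
  proof -
    obtain A where A: "A \<in> \<A> n" "x \<in> A" using atom_cover[OF n x] by blast
    have "(\<Sum>B\<in>\<A> n. c B * indicator B x) = (\<Sum>B\<in>\<A> n. if B = A then c A else 0)"
      using A atom_unique[OF n] by (intro sum.cong) (auto simp: indicator_def)
    then show ?thesis using A c finite_atoms[OF n] by simp
  qed
  moreover have "integrable unit_lebesgue (\<lambda>x. \<Sum>A\<in>\<A> n. c A * indicator A x)"
  proof (intro Bochner_Integration.integrable_sum integrable_mult_right)
    fix A assume A: "A \<in> \<A> n"
    have "emeasure unit_lebesgue A \<le> emeasure unit_lebesgue (space unit_lebesgue)"
      using sets_atom[OF n A] by (intro emeasure_mono sets.sets_into_space) auto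
    also have "\<dots> < \<infinity>" by (simp add: emeasure_restrict_space)
    finally show "integrable unit_lebesgue (indicator A :: real \<Rightarrow> real)"
      using sets_atom[OF n A] by (intro integrable_real_indicator) auto
  qed
  ultimately show ?thesis
    by (subst Bochner_Integration.integrable_cong[OF refl, of _ _ "\<lambda>x. \<Sum>A\<in>\<A> n. c A * indicator A x"]) auto
qed

section \<open>Integrals of step functions against one Haar function\<close>

lemma split_subset: "n \<ge> 1 \<Longrightarrow> {\<alpha> n..<\<beta> n} \<subseteq> {0..<1}"
  using atom_subset split_atom by blast

lemma split_left_mem: "n \<ge> 1 \<Longrightarrow> \<alpha> n \<in> {\<alpha> n..<\<beta> n}"
  using split_less[of n] by simp

lemma step_fun_on_split:
  "n \<ge> 1 \<Longrightarrow> step_fun n u \<Longrightarrow> x \<in> {\<alpha> n..<\<beta> n} \<Longrightarrow> u x = u (\<alpha> n)"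
  using split_atom[of n] split_left_mem[of n] unfolding step_fun_def constant_on_def by metis

text \<open>An atom that is not split survives to level \<open>Suc n\<close>, so
  \<open>h (Suc n)\<close> is constant on it; its mean there is zero.\<close>

lemma h_off_split:
  assumes n: "n \<ge> 1" and x: "x \<in> {0..<1}" "x \<notin> {\<alpha> n..<\<beta> n}"
  shows "h (Suc n) x = 0"
proof -
  obtain A where A: "A \<in> \<A> n" "x \<in> A" using atom_cover[OF n x(1)] by blast
  then have "A \<in> \<A> (Suc n)" using x(2) by (auto simp: atoms_Suc[OF n])
  then have eq: "h (Suc n) y = h (Suc n) x" if "y \<in> A" for y
    using const[of "Suc n" A] A that unfolding constant_on_def by auto
  obtain a b where ab: "a < b" "A = {a..<b}" using atom_interval[OF n A(1)] by blast
  have "(LINT y:A|lebesgue. h (Suc n) y) = (LINT y:A|lebesgue. h (Suc n) x)"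
    using eq by (intro set_lebesgue_integral_cong) (auto simp: ab)
  also have "\<dots> = (b - a) * h (Suc n) x"
    using ab by (simp add: set_integral_const_interval)
  finally show ?thesis using mean_0[OF n A(1)] ab by simp
qed

lemma integral_step_h:
  assumes n: "n \<ge> 1" and u: "step_fun n u"
  shows "(\<integral>x. u x * h (Suc n) x \<partial>unit_lebesgue) = 0"
proof -
  have "u x * h (Suc n) x = indicator {\<alpha> n..<\<beta> n} x * (u (\<alpha> n) * h (Suc n) x)"
    if "x \<in> {0..<1}" for x
    using h_off_split[OF n that] step_fun_on_split[OF n u, of x] by (cases "x \<in> {\<alpha> n..<\<beta> n}") simp_all
  then have "(\<integral>x. u x * h (Suc n) x \<partial>unit_lebesgue) = (LINT x:{\<alpha> n..<\<beta> n}|lebesgue. u (\<alpha> n) * h (Suc n) x)"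
    by (intro set_integral_unit_lebesgue split_subset n)
  also have "\<dots> = u (\<alpha> n) * (LINT x:{\<alpha> n..<\<beta> n}|lebesgue. h (Suc n) x)"
    by (rule set_integral_mult_right)
  finally show ?thesis using mean_0[OF n split_atom[OF n]] by simp
qed

lemma integral_h_sq: "n \<ge> 1 \<Longrightarrow> (\<integral>x. (h n x)\<^sup>2 \<partial>unit_lebesgue) = 1"
  using norm_1[of n] unfolding L2_norm_def by simp

text \<open>The square of \<open>h (Suc n)\<close> is carried by the split interval and has integral
  1, so only the value of u on that interval counts; the left end point represents it.\<close>

lemma integral_step_h_sq:
  assumes n: "n \<ge> 1" and u: "step_fun n u"
  shows "(\<integral>x. u x * (h (Suc n) x)\<^sup>2 \<partial>unit_lebesgue) = u (\<alpha> n)"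
proof -
  have "(\<integral>x. u x * (h (Suc n) x)\<^sup>2 \<partial>unit_lebesgue) = (\<integral>x. u (\<alpha> n) * (h (Suc n) x)\<^sup>2 \<partial>unit_lebesgue)"
  proof (intro Bochner_Integration.integral_cong refl)
    fix x :: real assume "x \<in> space unit_lebesgue"
    then have "x \<in> {0..<1}" by simp
    then show "u x * (h (Suc n) x)\<^sup>2 = u (\<alpha> n) * (h (Suc n) x)\<^sup>2"
      using h_off_split[OF n, of x] step_fun_on_split[OF n u, of x] by (cases "x \<in> {\<alpha> n..<\<beta> n}") auto
  qed
  then show ?thesis using integral_h_sq[of "Suc n"] by simp
qed

text \<open>The result agrees with that for the square of \<open>h (Suc n)\<close>, which makes
  \<open>split_density n\<close> its conditional expectation.\<close>

lemma integral_step_split_density: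
  assumes n: "n \<ge> 1" and u: "step_fun n u"
  shows "(\<integral>x. u x * split_density n x \<partial>unit_lebesgue) = u (\<alpha> n)"
proof -
  have "u x * split_density n x = indicator {\<alpha> n..<\<beta> n} x * (u (\<alpha> n) / (\<beta> n - \<alpha> n))"
    if "x \<in> {0..<1}" for x
    using step_fun_on_split[OF n u, of x] by (cases "x \<in> {\<alpha> n..<\<beta> n}") (simp_all add: split_density_def)
  then have "(\<integral>x. u x * split_density n x \<partial>unit_lebesgue) = (LINT x:{\<alpha> n..<\<beta> n}|lebesgue. (u (\<alpha> n) / (\<beta> n - \<alpha> n)))"
    by (intro set_integral_unit_lebesgue split_subset n)
  then show ?thesis using split_less[OF n] by (simp add: set_integral_const_interval)
qed

section \<open>Partial sums and their square functions\<close>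

definition haar_sum :: "(nat \<Rightarrow> real) \<Rightarrow> nat \<Rightarrow> real \<Rightarrow> real" where
  "haar_sum e n x = (\<Sum>j=1..n. e j * h j x)"

lemma step_fun_haar_sum: "n \<ge> 1 \<Longrightarrow> step_fun n (haar_sum e n)"
  unfolding haar_sum_def by (intro step_fun_sum step_fun_mult step_fun_const step_fun_h) auto

lemma haar_sum_Suc: "haar_sum e (Suc n) x = haar_sum e n x + e (Suc n) * h (Suc n) x"
  by (simp add: haar_sum_def)

text \<open>Parseval by induction: the cross term vanishes because the previous partial sum is a
  step function of the level before the new split.\<close>

lemma integral_haar_sum_sq:
  "n \<ge> 1 \<Longrightarrow> (\<integral>x. (haar_sum e n x)\<^sup>2 \<partial>unit_lebesgue) = (\<Sum>j=1..n. (e j)\<^sup>2)"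
proof (induction n rule: nat_induct_at_least)
  case base
  then show ?case using integral_h_sq[of 1] by (simp add: haar_sum_def power_mult_distrib)
next
  case (Suc n)
  note st = step_fun_haar_sum[OF Suc(1), of e]
  have u: "step_fun n (\<lambda>x. 2 * e (Suc n) * haar_sum e n x)" by (intro step_fun_mult step_fun_const st)
  have i: "integrable unit_lebesgue (\<lambda>x. (haar_sum e n x)\<^sup>2)"
    "integrable unit_lebesgue (\<lambda>x. 2 * e (Suc n) * haar_sum e n x * h (Suc n) x)"
    "integrable unit_lebesgue (\<lambda>x. (e (Suc n))\<^sup>2 * (h (Suc n) x)\<^sup>2)"
    using step_fun_Suc[OF Suc(1) st] step_fun_Suc[OF Suc(1) u] step_fun_h[of "Suc n" "Suc n"]
    by (intro step_fun_integrable[of "Suc n"] step_fun_mult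
        step_fun_power step_fun_const; simp)+
  have "(haar_sum e (Suc n) x)\<^sup>2 = (haar_sum e n x)\<^sup>2 + 2 * e (Suc n) * haar_sum e n x * h (Suc n) x
      + (e (Suc n))\<^sup>2 * (h (Suc n) x)\<^sup>2" for x
    unfolding haar_sum_Suc by (simp add: power2_eq_square algebra_simps)
  then have "(\<integral>x. (haar_sum e (Suc n) x)\<^sup>2 \<partial>unit_lebesgue) =
     (\<integral>x. (haar_sum e n x)\<^sup>2 \<partial>unit_lebesgue) + (\<integral>x. 2 * e (Suc n) * haar_sum e n x * h (Suc n) x \<partial>unit_lebesgue)
       + (\<integral>x. (e (Suc n))\<^sup>2 * (h (Suc n) x)\<^sup>2 \<partial>unit_lebesgue)"
    using i by (simp del: integral_mult_right_zero)
  then show ?case using Suc integral_step_h[OF Suc(1) u] integral_h_sq[of "Suc n"] by simp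
qed

text \<open>This is 32 times the sum of the square function and the conditional square function for
  the coefficients b; the step inequality demands the 32. The sum starts at \<open>h 2\<close>,
  since \<open>h 1\<close> arises from no split; its contribution is covered by the starting value D
  of the weight.\<close>

definition square_sum :: "(nat \<Rightarrow> real) \<Rightarrow> nat \<Rightarrow> real \<Rightarrow> real" where
  "square_sum b n x = (\<Sum>j=1..<n. 32 * (b (Suc j))\<^sup>2 * ((h (Suc j) x)\<^sup>2 + split_density j x))"

lemma split_density_nonneg: "n \<ge> 1 \<Longrightarrow> split_density n x \<ge> 0"
  using split_less[of n] by (simp add: split_density_def)

lemma square_sum_nonneg: "square_sum b n x \<ge> 0"
  unfolding square_sum_def by (intro sum_nonneg mult_nonneg_nonneg add_nonneg_nonneg split_density_nonneg) auto

lemma square_sum_Suc: "n \<ge> 1 \<Longrightarrow> square_sum b (Suc n) x =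
    square_sum b n x + 32 * (b (Suc n))\<^sup>2 * ((h (Suc n) x)\<^sup>2 + split_density n x)"
  by (simp add: square_sum_def)

lemma step_fun_square_term:
  "n \<ge> 1 \<Longrightarrow> step_fun (Suc n) (\<lambda>x. 32 * (b (Suc n))\<^sup>2 * ((h (Suc n) x)\<^sup>2 + split_density n x))"
  by (intro step_fun_mult step_fun_add step_fun_power step_fun_const step_fun_h
      step_fun_Suc[OF _ step_fun_split_density]) auto

lemma step_fun_square_sum: "n \<ge> 1 \<Longrightarrow> step_fun n (square_sum b n)"
  unfolding square_sum_def
  by (intro step_fun_sum step_fun_mono[OF _ _ step_fun_square_term]) auto

lemma integral_square_term:
  assumes n: "n \<ge> 1"
  shows "(\<integral>x. 32 * (b (Suc n))\<^sup>2 * ((h (Suc n) x)\<^sup>2 + split_density n x) \<partial>unit_lebesgue) = 64 * (b (Suc n))\<^sup>2"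
proof -
  have i: "integrable unit_lebesgue (\<lambda>x. (h (Suc n) x)\<^sup>2)" "integrable unit_lebesgue (split_density n)"
    using n by (intro step_fun_integrable[of "Suc n"] step_fun_power step_fun_h step_fun_Suc step_fun_split_density; simp)+
  show ?thesis
    using integral_h_sq[of "Suc n"] integral_step_split_density[OF n step_fun_const[of _ 1]] i
    by simp
qed

lemma integral_square_sum:
  assumes n: "n \<ge> 1"
  shows "(\<integral>x. square_sum b n x \<partial>unit_lebesgue) = 64 * (\<Sum>j=1..<n. (b (Suc j))\<^sup>2)"
proof -
  have "(\<integral>x. square_sum b n x \<partial>unit_lebesgue) =
     (\<Sum>j=1..<n. \<integral>x. 32 * (b (Suc j))\<^sup>2 * ((h (Suc j) x)\<^sup>2 + split_density j x) \<partial>unit_lebesgue)"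
    unfolding square_sum_def
    by (intro Bochner_Integration.integral_sum step_fun_integrable[OF _ step_fun_square_term]) auto
  also have "\<dots> = (\<Sum>j=1..<n. 64 * (b (Suc j))\<^sup>2)"
    by (intro sum.cong integral_square_term) auto
  finally show ?thesis by (simp add: sum_distrib_left)
qed

subsection \<open>The upper bound\<close>

lemma step_fun_gauss_weight:
  "n \<ge> 1 \<Longrightarrow> step_fun n (\<lambda>x. gauss_weight (haar_sum e n x) (D + square_sum b n x))"
  using step_fun_compose2[where \<phi> = "\<lambda>x q. gauss_weight x (D + q)"]
    step_fun_haar_sum step_fun_square_sum by blast

text \<open>The step inequality with d the new summand and v = \<open>r\<close> its conditional
  variance. It is arranged as level-n step functions times \<open>h (Suc n)\<close>, its square and
  \<open>split_density n\<close>, because these terms integrate to zero or cancel. As b only has to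
  dominate e, one Q serves several choices of e.\<close>

lemma gauss_weight_Suc_le:
  assumes n: "n \<ge> 1" and D: "D > 0" and eb: "\<bar>e (Suc n)\<bar> \<le> \<bar>b (Suc n)\<bar>"
  defines "X \<equiv> haar_sum e n" and "Q \<equiv> \<lambda>x. D + square_sum b n x"
    and "r \<equiv> (e (Suc n))\<^sup>2 / (\<beta> n - \<alpha> n)"
  defines "\<phi> \<equiv> \<lambda>x. gauss_weight (X x) (Q x) / (1 + 2 * (X x)\<^sup>2 * r / (Q x)\<^sup>2)"
  assumes x: "x \<in> {0..<1}"
  shows "gauss_weight (haar_sum e (Suc n) x) (D + square_sum b (Suc n) x) \<le>
    gauss_weight (X x) (Q x)
    + (\<phi> x * (2 * X x * e (Suc n) / Q x)) * h (Suc n) x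
    + (\<phi> x * (2 * (X x)\<^sup>2 * (e (Suc n))\<^sup>2 / (Q x)\<^sup>2)) * (h (Suc n) x)\<^sup>2
    - (\<phi> x * (2 * (X x)\<^sup>2 * (e (Suc n))\<^sup>2 / (Q x)\<^sup>2)) * split_density n x
    + self_normalized_const * (32 * (b (Suc n))\<^sup>2 * ((h (Suc n) x)\<^sup>2 + split_density n x))"
proof (cases "x \<in> {\<alpha> n..<\<beta> n}")
  case False
  then have "h (Suc n) x = 0" "split_density n x = 0"
    using h_off_split[OF n x] by (auto simp: split_density_def)
  then show ?thesis by (simp add: haar_sum_Suc square_sum_Suc[OF n] X_def Q_def)
next
  case True
  define d where "d = e (Suc n) * h (Suc n) x"
  define s where "s = 32 * (b (Suc n))\<^sup>2 * ((h (Suc n) x)\<^sup>2 + split_density n x)"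
  have w: "split_density n x = 1 / (\<beta> n - \<alpha> n)" using True by (simp add: split_density_def)
  have len: "\<beta> n - \<alpha> n > 0" using split_less[OF n] by simp
  have r0: "r \<ge> 0" using len by (simp add: r_def)
  have Q: "Q x > 0" using D square_sum_nonneg[of b n x] by (simp add: Q_def)
  have "(e (Suc n))\<^sup>2 \<le> (b (Suc n))\<^sup>2" using eb by (simp add: abs_le_square_iff)
  then have "(e (Suc n))\<^sup>2 * ((h (Suc n) x)\<^sup>2 + split_density n x) \<le> (b (Suc n))\<^sup>2 * ((h (Suc n) x)\<^sup>2 + split_density n x)"
    using split_density_nonneg[OF n] by (intro mult_right_mono) auto
  then have s: "32 * (d\<^sup>2 + r) \<le> s"
    by (simp add: s_def d_def r_def w power_mult_distrib distrib_left)
  have k: "1 + 2 * (X x)\<^sup>2 * r / (Q x)\<^sup>2 > 0" using r0 by (intro add_pos_nonneg) auto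
  have "gauss_weight (X x + d) (Q x + s) \<le> \<phi> x * (1 + 2 * X x * d / Q x + 2 * (X x)\<^sup>2 * d\<^sup>2 / (Q x)\<^sup>2)
      + self_normalized_const * s"
    using self_normalized_step[OF Q r0 s] by (simp add: \<phi>_def)
  \<comment> \<open>On the split interval \<open>r\<close> is the squared coefficient times
    \<open>split_density n x\<close>; clearing the denominator thus writes \<phi> as the weight
    minus a compensator.\<close>
  moreover have "\<phi> x * (1 + 2 * (X x)\<^sup>2 * r / (Q x)\<^sup>2) = gauss_weight (X x) (Q x)"
    using k by (simp add: \<phi>_def)
  then have "\<phi> x = gauss_weight (X x) (Q x) - (\<phi> x * (2 * (X x)\<^sup>2 * (e (Suc n))\<^sup>2 / (Q x)\<^sup>2)) * split_density n x"
    by (simp add: r_def w distrib_left eq_diff_eq mult.commute mult.left_commute)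
  moreover have "\<phi> x * (1 + 2 * X x * d / Q x + 2 * (X x)\<^sup>2 * d\<^sup>2 / (Q x)\<^sup>2) =
    \<phi> x + (\<phi> x * (2 * X x * e (Suc n) / Q x)) * h (Suc n) x
    + (\<phi> x * (2 * (X x)\<^sup>2 * (e (Suc n))\<^sup>2 / (Q x)\<^sup>2)) * (h (Suc n) x)\<^sup>2"
    by (simp add: d_def power_mult_distrib algebra_simps)
  ultimately show ?thesis
    unfolding s_def[symmetric] using d_def s_def
    by (simp add: haar_sum_Suc square_sum_Suc[OF n] X_def[symmetric] add.assoc[symmetric] Q_def)
qed

lemma h_1_sq: "x \<in> {0..<1} \<Longrightarrow> (h 1 x)\<^sup>2 = 1"
proof -
  assume x: "x \<in> {0..<1}"
  obtain c where c: "\<And>y. y \<in> {0..<1} \<Longrightarrow> h 1 y = c"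
    using const[of 1 "{0..<1}"] atoms_1 unfolding constant_on_def by auto
  have "(\<integral>y. (h 1 y)\<^sup>2 \<partial>unit_lebesgue) = (LINT y:{0..<1::real}|lebesgue. c\<^sup>2)"
    using c by (intro set_integral_unit_lebesgue) auto
  then show ?thesis using integral_h_sq[of 1] c[OF x] by (simp add: set_integral_const_interval)
qed

text \<open>Induction with the one-step bound: the term linear in \<open>h (Suc n)\<close>
  integrates to 0, the terms with its square and with \<open>split_density\<close> cancel, and only
  the increments of the square sum remain. At n = 1 the weight is at most D exp 1, since
  \<open>(h 1)\<^sup>2 = 1\<close>.\<close>

lemma integral_gauss_weight_le:
  assumes n: "n \<ge> 1" and D: "D > 0" and e1: "(e 1)\<^sup>2 \<le> D" and eb: "\<And>j. \<bar>e j\<bar> \<le> \<bar>b j\<bar>"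
  shows "(\<integral>x. gauss_weight (haar_sum e n x) (D + square_sum b n x) \<partial>unit_lebesgue)
    \<le> 3 * D + self_normalized_const * (64 * (\<Sum>j=1..<n. (b (Suc j))\<^sup>2))"
  using n
proof (induction n rule: nat_induct_at_least)
  case base
  have "gauss_weight (haar_sum e 1 x) (D + square_sum b 1 x) \<le> 3 * D" if "x \<in> {0..<1}" for x
  proof -
    have "gauss_weight (haar_sum e 1 x) (D + square_sum b 1 x) = D * exp ((e 1)\<^sup>2 / D)"
      using h_1_sq[OF that] by (simp add: haar_sum_def square_sum_def gauss_weight_def power_mult_distrib)
    also have "\<dots> \<le> D * exp 1" using e1 D by (intro mult_left_mono) auto
    also have "\<dots> \<le> D * 3" using exp_le D by (intro mult_left_mono) auto
    finally show ?thesis by simp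
  qed
  then have "(\<integral>x. gauss_weight (haar_sum e 1 x) (D + square_sum b 1 x) \<partial>unit_lebesgue)
     \<le> (\<integral>x. 3 * D \<partial>unit_lebesgue)"
    by (intro integral_mono step_fun_integrable[of 1] step_fun_gauss_weight step_fun_const) auto
  also have "\<dots> = 3 * D" by (simp add: measure_restrict_space)
  finally show ?case by simp
next
  case (Suc n)
  define X where "X = haar_sum e n"
  define Q where "Q = (\<lambda>x. D + square_sum b n x)"
  define r where "r = (e (Suc n))\<^sup>2 / (\<beta> n - \<alpha> n)"
  define \<phi> where "\<phi> = (\<lambda>x. gauss_weight (X x) (Q x) / (1 + 2 * (X x)\<^sup>2 * r / (Q x)\<^sup>2))"
  define u where "u = (\<lambda>x. \<phi> x * (2 * X x * e (Suc n) / Q x))"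
  define v where "v = (\<lambda>x. \<phi> x * (2 * (X x)\<^sup>2 * (e (Suc n))\<^sup>2 / (Q x)\<^sup>2))"
  note XQ = step_fun_haar_sum[OF Suc(1), of e, folded X_def] step_fun_square_sum[OF Suc(1), of b]
  have u: "step_fun n u" unfolding u_def \<phi>_def Q_def
    by (rule step_fun_compose2[OF XQ, of "\<lambda>x q. gauss_weight x (D + q) / (1 + 2 * x\<^sup>2 * r / (D + q)\<^sup>2) * (2 * x * e (Suc n) / (D + q))"])
  have v: "step_fun n v" unfolding v_def \<phi>_def Q_def
    by (rule step_fun_compose2[OF XQ, of "\<lambda>x q. gauss_weight x (D + q) / (1 + 2 * x\<^sup>2 * r / (D + q)\<^sup>2) * (2 * x\<^sup>2 * (e (Suc n))\<^sup>2 / (D + q)\<^sup>2)"])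
  define S where "S = (\<lambda>x. 32 * (b (Suc n))\<^sup>2 * ((h (Suc n) x)\<^sup>2 + split_density n x))"
  note u' = step_fun_Suc[OF Suc(1) u] and v' = step_fun_Suc[OF Suc(1) v]
    and h' = step_fun_h[of "Suc n" "Suc n", simplified]
    and w' = step_fun_Suc[OF Suc(1) step_fun_split_density[OF Suc(1)]]
  have int: "integrable unit_lebesgue (\<lambda>x. gauss_weight (X x) (Q x))"
    "integrable unit_lebesgue (\<lambda>x. u x * h (Suc n) x)"
    "integrable unit_lebesgue (\<lambda>x. v x * (h (Suc n) x)\<^sup>2)"
    "integrable unit_lebesgue (\<lambda>x. v x * split_density n x)"
    "integrable unit_lebesgue (\<lambda>x. self_normalized_const * S x)"
    unfolding X_def Q_def S_def
    by (rule step_fun_integrable[OF Suc(1) step_fun_gauss_weight[OF Suc(1)]]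
        step_fun_integrable[OF _ step_fun_mult[OF u' h']] step_fun_integrable[OF _ step_fun_mult[OF v' step_fun_power[OF h']]]
        step_fun_integrable[OF _ step_fun_mult[OF v' w']]
        step_fun_integrable[OF _ step_fun_mult[OF step_fun_const step_fun_square_term[OF Suc(1)]]]; simp)+
  have "(\<integral>x. gauss_weight (haar_sum e (Suc n) x) (D + square_sum b (Suc n) x) \<partial>unit_lebesgue) \<le>
     (\<integral>x. gauss_weight (X x) (Q x) + u x * h (Suc n) x + v x * (h (Suc n) x)\<^sup>2 - v x * split_density n x
        + self_normalized_const * S x \<partial>unit_lebesgue)"
  proof (intro integral_mono)
    show "integrable unit_lebesgue (\<lambda>x. gauss_weight (haar_sum e (Suc n) x) (D + square_sum b (Suc n) x))"
      by (intro step_fun_integrable[of "Suc n"] step_fun_gauss_weight) auto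
    fix x :: real assume "x \<in> space unit_lebesgue"
    then have x: "x \<in> {0..<1}" by simp
    show "gauss_weight (haar_sum e (Suc n) x) (D + square_sum b (Suc n) x) \<le>
      gauss_weight (X x) (Q x) + u x * h (Suc n) x + v x * (h (Suc n) x)\<^sup>2 - v x * split_density n x
        + self_normalized_const * S x"
      unfolding X_def Q_def u_def v_def \<phi>_def r_def S_def
      by (rule gauss_weight_Suc_le[OF Suc(1) D eb x])
  qed (intro Bochner_Integration.integrable_add Bochner_Integration.integrable_diff int)
  also have "\<dots> = (\<integral>x. gauss_weight (X x) (Q x) \<partial>unit_lebesgue) + (\<integral>x. u x * h (Suc n) x \<partial>unit_lebesgue)
      + (\<integral>x. v x * (h (Suc n) x)\<^sup>2 \<partial>unit_lebesgue) - (\<integral>x. v x * split_density n x \<partial>unit_lebesgue)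
      + (\<integral>x. self_normalized_const * S x \<partial>unit_lebesgue)"
    using int by (simp del: integral_mult_right_zero integrable_mult_right_iff)
  also have "\<dots> = (\<integral>x. gauss_weight (X x) (Q x) \<partial>unit_lebesgue) + self_normalized_const * (64 * (b (Suc n))\<^sup>2)"
    using integral_step_h[OF Suc(1) u] integral_step_h_sq[OF Suc(1) v]
      integral_step_split_density[OF Suc(1) v] integral_square_term[OF Suc(1), of b]
    by (simp add: S_def)
  also have "\<dots> \<le> 3 * D + self_normalized_const * (64 * (\<Sum>j=1..<n. (b (Suc j))\<^sup>2)) + self_normalized_const * (64 * (b (Suc n))\<^sup>2)"
    using Suc(2) by (simp add: X_def Q_def)
  also have "\<dots> = 3 * D + self_normalized_const * (64 * (\<Sum>j=1..<Suc n. (b (Suc j))\<^sup>2))"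
    using Suc(1) by (simp add: distrib_left)
  finally show ?case .
qed

section \<open>The maximal inequality\<close>

lemma maximal_function_upper:
  fixes n :: nat
  assumes n: "n \<ge> 2" and p: "p \<in> monotonic_polynomials h n"
  shows "L2_norm (\<lambda>x. MAX m\<in>{1..n}. \<bar>p m x\<bar>) / L2_norm (p n)
    \<le> sqrt (71 + 128 * self_normalized_const) * sqrt (log 2 n)"
proof -
  obtain G c where G: "\<forall>k\<in>{1..n}. finite (G k) \<and> G k \<subseteq> {1..}"
    "\<forall>k\<in>{1..<n}. G k \<subseteq> G (Suc k)"
    "\<forall>k\<in>{1..n}. p k = (\<lambda>x. \<Sum>j\<in>G k. c j * h j x)"
    "(\<Sum>j\<in>G n. (c j)\<^sup>2) \<noteq> 0"
    using p unfolding monotonic_polynomials_def by blast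
  define N where "N = Max (insert 1 (G n))"
  have fin: "finite (G n)" using G(1) n by auto
  have N: "N \<ge> 1" "G n \<subseteq> {1..N}"
  proof -
    have "G n \<subseteq> {1..}" using G(1) n by simp
    moreover have "j \<le> N" if "j \<in> insert 1 (G n)" for j
      unfolding N_def using fin that by (intro Max_ge) auto
    ultimately show "N \<ge> 1" "G n \<subseteq> {1..N}" by auto
  qed
  have mono: "G k \<subseteq> G n" if "k \<in> {1..n}" for k
  proof -
    have "k \<le> n" using that by simp
    then show ?thesis using that
    proof (induction k rule: inc_induct)
      case (step k)
      have "G k \<subseteq> G (Suc k)" using G(2) step by simp
      also have "\<dots> \<subseteq> G n" using step by simp
      finally show ?case .
    qed simp
  qed
  \<comment> \<open>Padding with zeros makes every polynomial a partial sum of the same length N;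
    nested spectra give \<open>\<bar>e k j\<bar> \<le> \<bar>e n j\<bar>\<close>.\<close>
  define e where "e k j = (if j \<in> G k then c j else 0)" for k j
  have pe: "p k = haar_sum (e k) N" if "k \<in> {1..n}" for k
  proof
    fix x
    have "haar_sum (e k) N x = (\<Sum>j\<in>{1..N}. if j \<in> G k then c j * h j x else 0)"
      unfolding haar_sum_def e_def by (intro sum.cong) auto
    also have "\<dots> = (\<Sum>j\<in>{1..N} \<inter> G k. c j * h j x)" by (simp add: sum.inter_restrict)
    also have "{1..N} \<inter> G k = G k" using mono[OF that] N by auto
    finally show "p k x = haar_sum (e k) N x" using G(3) that by simp
  qed
  define D where "D = (\<Sum>j=1..N. (e n j)\<^sup>2)"
  have "D = (\<Sum>j\<in>{1..N}. if j \<in> G n then (c j)\<^sup>2 else 0)"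
    unfolding D_def e_def by (intro sum.cong) auto
  also have "\<dots> = (\<Sum>j\<in>{1..N} \<inter> G n. (c j)\<^sup>2)" by (simp add: sum.inter_restrict)
  also have "{1..N} \<inter> G n = G n" using N by auto
  finally have "D \<noteq> 0" using G(4) by simp
  moreover have "D \<ge> 0" unfolding D_def by (intro sum_nonneg) auto
  ultimately have D: "D > 0" by simp
  have pn: "L2_norm (p n) = sqrt D"
    using pe[of n] n integral_haar_sum_sq[OF N(1), of "e n"] by (simp add: L2_norm_def D_def)
  have eb: "\<bar>e k j\<bar> \<le> \<bar>e n j\<bar>" if "k \<in> {1..n}" for k j
    using mono[OF that] by (auto simp: e_def)
  have e1: "(e k 1)\<^sup>2 \<le> D" if "k \<in> {1..n}" for k
  proof -
    have "(e k 1)\<^sup>2 \<le> (e n 1)\<^sup>2" using eb[OF that] by (simp add: abs_le_square_iff)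
    also have "\<dots> \<le> D" unfolding D_def using N by (intro member_le_sum) auto
    finally show ?thesis .
  qed
  have sum_D: "(\<Sum>j=1..<N. (e n (Suc j))\<^sup>2) \<le> D"
  proof -
    have "(\<Sum>j=1..<N. (e n (Suc j))\<^sup>2) = (\<Sum>j\<in>Suc ` {1..<N}. (e n j)\<^sup>2)"
      by (subst sum.reindex) auto
    also have "\<dots> \<le> D" unfolding D_def by (intro sum_mono2) auto
    finally show ?thesis .
  qed
  have C0: "self_normalized_const \<ge> 0" by (simp add: self_normalized_const_def)
  \<comment> \<open>Built from the coefficients of the last polynomial, which dominate all the
    others, Q is the same for every k.\<close>
  define Q where "Q = (\<lambda>x. D + square_sum (e n) N x)"
  define W where "W = (\<lambda>k x. gauss_weight (haar_sum (e k) N x) (Q x))"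
  have Q: "Q x > 0" for x using D square_sum_nonneg[of "e n" N x] by (simp add: Q_def)
  have W0: "W k x \<ge> 0" for k x using Q[of x] by (simp add: W_def gauss_weight_def)
  have "step_fun N (\<lambda>x. D + square_sum (e n) N x)"
    by (intro step_fun_add step_fun_const step_fun_square_sum N)
  then have Qint: "integrable unit_lebesgue Q" unfolding Q_def by (rule step_fun_integrable[OF N(1)])
  have Wint: "integrable unit_lebesgue (W k)" for k
    unfolding W_def Q_def by (intro step_fun_integrable[OF N(1)] step_fun_gauss_weight N)
  have intQ: "(\<integral>x. Q x \<partial>unit_lebesgue) \<le> 65 * D"
  proof -
    have "(\<integral>x. Q x \<partial>unit_lebesgue) = D + 64 * (\<Sum>j=1..<N. (e n (Suc j))\<^sup>2)"
      unfolding Q_def using integral_square_sum[OF N(1)]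
      by (subst Bochner_Integration.integral_add[OF
            step_fun_integrable[OF N(1) step_fun_const] step_fun_integrable[OF N(1) step_fun_square_sum[OF N(1)]]])
        (simp add: measure_restrict_space)
    then show ?thesis using sum_D by simp
  qed
  have intW: "(\<integral>x. W k x \<partial>unit_lebesgue) \<le> (3 + 64 * self_normalized_const) * D" if "k \<in> {1..n}" for k
  proof -
    have "(\<integral>x. W k x \<partial>unit_lebesgue) \<le> 3 * D + self_normalized_const * (64 * (\<Sum>j=1..<N. (e n (Suc j))\<^sup>2))"
      unfolding W_def Q_def by (intro integral_gauss_weight_le N D e1 eb that)
    also have "\<dots> \<le> 3 * D + self_normalized_const * (64 * D)"
      using C0 sum_D by (intro add_left_mono mult_left_mono) auto
    finally show ?thesis by (simp add: algebra_simps)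
  qed
  define M where "M = (\<lambda>x. MAX m\<in>{1..n}. \<bar>p m x\<bar>)"
  define R where "R = (\<lambda>x. Q x * ln n + (\<Sum>k=1..n. W k x) / n)"
  have MR: "(M x)\<^sup>2 \<le> R x" for x
  proof -
    have "M x \<in> (\<lambda>m. \<bar>p m x\<bar>) ` {1..n}" unfolding M_def using n by (intro Max_in) auto
    then obtain k where k: "k \<in> {1..n}" "M x = \<bar>p k x\<bar>" by auto
    \<comment> \<open>The maximizing k varies with x; only the second term sees it, and there the
      sum over all k is a bound.\<close>
    have "(M x)\<^sup>2 \<le> Q x * ln n + W k x / n"
      using square_le_ln_gauss_weight[OF Q, of n "haar_sum (e k) N x" x] n k pe[OF k(1)] by (simp add: W_def)
    also have "\<dots> \<le> R x" unfolding R_def using W0 k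
      by (intro add_left_mono divide_right_mono member_le_sum) auto
    finally show ?thesis .
  qed
  have Rint: "integrable unit_lebesgue R"
    unfolding R_def using Qint Wint
    by (intro Bochner_Integration.integrable_add integrable_mult_left integrable_divide Bochner_Integration.integrable_sum) auto
  have "(\<integral>x. (M x)\<^sup>2 \<partial>unit_lebesgue) \<le> (\<integral>x. R x \<partial>unit_lebesgue)"
    using Rint MR order_trans[OF zero_le_power2 MR] by (intro integral_mono') auto
  also have "\<dots> = (\<integral>x. Q x \<partial>unit_lebesgue) * ln n + (\<Sum>k=1..n. \<integral>x. W k x \<partial>unit_lebesgue) / n"
    unfolding R_def using Qint Wint by simp
  \<comment> \<open>The n error integrals, divided by n, contribute a constant multiple of
    D.\<close>
  also have "\<dots> \<le> (65 * D) * ln n + (\<Sum>k=1..n. (3 + 64 * self_normalized_const) * D) / n"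
    using intQ intW n by (intro add_mono mult_right_mono divide_right_mono sum_mono) auto
  also have "\<dots> = (65 * ln n + (3 + 64 * self_normalized_const)) * D"
    using n by (simp add: field_simps)
  \<comment> \<open>Since n >= 2, log 2 n >= 1 absorbs the constant term.\<close>
  also have "\<dots> \<le> ((71 + 128 * self_normalized_const) * log 2 n) * D"
  proof (intro mult_right_mono)
    have l1: "log 2 n \<ge> 1" using n by simp
    have "ln 2 \<le> (1::real)" using ln_2_less_1 by simp
    then have "ln n \<le> log 2 n" using n by (simp add: log_def field_simps mult_left_le)
    moreover have "3 + 64 * self_normalized_const \<le> (6 + 128 * self_normalized_const) * log 2 n"
    proof -
      have "3 + 64 * self_normalized_const \<le> (6 + 128 * self_normalized_const) * 1" using C0 by simp
      also have "\<dots> \<le> (6 + 128 * self_normalized_const) * log 2 n" using l1 C0 by (intro mult_left_mono) auto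
      finally show ?thesis .
    qed
    ultimately show "65 * ln n + (3 + 64 * self_normalized_const) \<le> (71 + 128 * self_normalized_const) * log 2 n"
      by (simp add: algebra_simps)
  qed (use D in auto)
  finally have "sqrt (\<integral>x. (M x)\<^sup>2 \<partial>unit_lebesgue) \<le> sqrt (((71 + 128 * self_normalized_const) * log 2 n) * D)"
    by (rule real_sqrt_le_mono)
  then have "L2_norm M \<le> sqrt (71 + 128 * self_normalized_const) * sqrt (log 2 n) * sqrt D"
    by (simp add: L2_norm_def real_sqrt_mult)
  then show ?thesis using D unfolding pn M_def by (simp add: field_simps)
qed

end

subsection \<open>The lower bound\<close>

lemma binary_tail_less:
  fixes \<epsilon> :: "nat \<Rightarrow> nat"
  assumes "\<And>i. \<epsilon> i \<le> 1" "l \<le> r"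
  shows "(\<Sum>i=l..<r. \<epsilon> i * 2 ^ (r - 1 - i)) < 2 ^ (r - l)"
  using assms(2)
proof (induction l rule: inc_induct)
  case (step l)
  have "(\<Sum>i=l..<r. \<epsilon> i * 2 ^ (r - 1 - i)) = \<epsilon> l * 2 ^ (r - 1 - l) + (\<Sum>i=Suc l..<r. \<epsilon> i * 2 ^ (r - 1 - i))"
    using step(2) by (simp add: sum.atLeast_Suc_lessThan)
  also have "\<dots> < 1 * 2 ^ (r - 1 - l) + 2 ^ (r - Suc l)"
    using step(3) assms(1) by (intro add_le_less_mono mult_right_mono) auto
  also have "\<dots> = 2 ^ (r - l)"
    using step(2) by (simp flip: power_Suc mult_2 add: Suc_diff_Suc)
  finally show ?case .
qed simp

text \<open>The digits are a path from the root, 1 meaning right. The key of the level-l node on the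
  path is the prefix followed by 1 and zeros, its in-order number. If the path turns left there, the
  remaining digits stay below the place value 2^(r-1-l); if it turns right, the address already
  contains the key.\<close>

lemma in_order_key_le_iff:
  fixes \<epsilon> :: "nat \<Rightarrow> nat"
  assumes e: "\<And>i. \<epsilon> i \<le> 1" and l: "l < r"
  shows "(\<Sum>i<l. \<epsilon> i * 2 ^ (r - 1 - i)) + 2 ^ (r - 1 - l) \<le> (\<Sum>i<r. \<epsilon> i * 2 ^ (r - 1 - i))
    \<longleftrightarrow> \<epsilon> l = 1"
proof -
  have "(\<Sum>i<r. \<epsilon> i * 2 ^ (r - 1 - i)) = (\<Sum>i<l. \<epsilon> i * 2 ^ (r - 1 - i)) + (\<Sum>i=l..<r. \<epsilon> i * 2 ^ (r - 1 - i))"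
    using l by (simp add: lessThan_atLeast0 sum.atLeastLessThan_concat)
  also have "(\<Sum>i=l..<r. \<epsilon> i * 2 ^ (r - 1 - i)) = \<epsilon> l * 2 ^ (r - 1 - l) + (\<Sum>i=Suc l..<r. \<epsilon> i * 2 ^ (r - 1 - i))"
    using l by (simp add: sum.atLeast_Suc_lessThan)
  finally have eq: "(\<Sum>i<r. \<epsilon> i * 2 ^ (r - 1 - i)) = (\<Sum>i<l. \<epsilon> i * 2 ^ (r - 1 - i)) +
      (\<epsilon> l * 2 ^ (r - 1 - l) + (\<Sum>i=Suc l..<r. \<epsilon> i * 2 ^ (r - 1 - i)))" .
  have "(\<Sum>i=Suc l..<r. \<epsilon> i * 2 ^ (r - 1 - i)) < 2 ^ (r - 1 - l)"
    using binary_tail_less[of \<epsilon> "Suc l" r] e l by simp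
  moreover have "\<epsilon> l = 0 \<or> \<epsilon> l = 1" using e[of l] by linarith
  ultimately show ?thesis unfolding eq by auto
qed

lemma sum_blocks:
  fixes N :: "nat \<Rightarrow> nat"
  assumes "mono N"
  shows "(\<Sum>j\<in>{N 0<..N r}. f j) = (\<Sum>l<r. \<Sum>j\<in>{N l<..N (Suc l)}. f j :: 'a :: comm_monoid_add)"
proof (induction r)
  case (Suc r)
  have "N 0 \<le> N r" "N r \<le> N (Suc r)" using assms by (auto simp: mono_def)
  then have "{N 0<..N (Suc r)} = {N 0<..N r} \<union> {N r<..N (Suc r)}" by auto
  then have "(\<Sum>j\<in>{N 0<..N (Suc r)}. f j) = (\<Sum>j\<in>{N 0<..N r}. f j) + (\<Sum>j\<in>{N r<..N (Suc r)}. f j)"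
    by (simp only:) (intro sum.union_disjoint; auto)
  then show ?case using Suc by simp
qed simp

section \<open>Haar polynomials from mean-zero step functions\<close>

context haar_system
begin

definition mean_zero :: "nat \<Rightarrow> (real \<Rightarrow> real) \<Rightarrow> bool" where
  "mean_zero n u \<longleftrightarrow> (\<forall>A\<in>\<A> n. (\<integral>x. indicator A x * u x \<partial>unit_lebesgue) = 0)"

lemma step_fun_eq: "step_fun n f \<Longrightarrow> A \<in> \<A> n \<Longrightarrow> x \<in> A \<Longrightarrow> y \<in> A \<Longrightarrow> f x = f y"
  unfolding step_fun_def constant_on_def by metis

lemma step_funI: "(\<And>A x y. A \<in> \<A> n \<Longrightarrow> x \<in> A \<Longrightarrow> y \<in> A \<Longrightarrow> f x = f y) \<Longrightarrow> step_fun n f"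
  unfolding step_fun_def constant_on_def by blast

lemma step_fun_indicator_atom:
  assumes "n \<ge> 1" "A \<in> \<A> n" shows "step_fun n (indicator A :: real \<Rightarrow> real)"
proof (rule step_funI)
  fix B x y assume "B \<in> \<A> n" "x \<in> B" "y \<in> B"
  then have "x \<in> A \<longleftrightarrow> y \<in> A" using atom_unique[OF assms(1)] assms(2) by blast
  then show "(indicator A x :: real) = indicator A y" by (simp add: indicator_def)
qed

lemma step_fun_on_halves:
  assumes n: "n \<ge> 1" and f: "step_fun (Suc n) f"
  shows "x \<in> {\<alpha> n..<\<gamma> n} \<Longrightarrow> f x = f (\<alpha> n)" "x \<in> {\<gamma> n..<\<beta> n} \<Longrightarrow> f x = f (\<gamma> n)"
  using split_less[OF n] step_fun_eq[OF f, of "{\<alpha> n..<\<gamma> n}" x "\<alpha> n"]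
    step_fun_eq[OF f, of "{\<gamma> n..<\<beta> n}" x "\<gamma> n"] by (simp_all add: atoms_Suc[OF n])

text \<open>Equal values would make \<open>h (Suc n)\<close> constant on the split interval, hence
  zero by its mean, against norm 1. The expansion below divides by this difference.\<close>

lemma h_halves_neq:
  assumes n: "n \<ge> 1" shows "h (Suc n) (\<gamma> n) \<noteq> h (Suc n) (\<alpha> n)"
proof
  assume eq: "h (Suc n) (\<gamma> n) = h (Suc n) (\<alpha> n)"
  have hs: "step_fun (Suc n) (h (Suc n))" by (rule step_fun_h) auto
  have c: "h (Suc n) x = h (Suc n) (\<alpha> n)" if "x \<in> {\<alpha> n..<\<beta> n}" for x
    using step_fun_on_halves[OF n hs, of x] eq that by (cases "x < \<gamma> n") auto
  have "(LINT x:{\<alpha> n..<\<beta> n}|lebesgue. h (Suc n) x) = (LINT x:{\<alpha> n..<\<beta> n}|lebesgue. h (Suc n) (\<alpha> n))"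
    by (intro set_lebesgue_integral_cong allI impI c) simp_all
  also have "\<dots> = (\<beta> n - \<alpha> n) * h (Suc n) (\<alpha> n)"
    using split_less[OF n] by (simp add: set_integral_const_interval)
  finally have "h (Suc n) (\<alpha> n) = 0" using mean_0[OF n split_atom[OF n]] split_less[OF n] by simp
  then have "h (Suc n) x = 0" if "x \<in> {0..<1}" for x
    using c[of x] h_off_split[OF n that] by (cases "x \<in> {\<alpha> n..<\<beta> n}") auto
  then have "(\<integral>x. (h (Suc n) x)\<^sup>2 \<partial>unit_lebesgue) = (\<integral>x. 0 \<partial>unit_lebesgue)"
    by (intro Bochner_Integration.integral_cong) auto
  then show False using integral_h_sq[of "Suc n"] by simp
qed

text \<open>Descent through the levels: subtracting a multiple of \<open>h (Suc m)\<close> equalizes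
  the values on the two halves of the m-th split and leaves a step function of level m. The means
  over the atoms of level n stay zero, and at level n itself this forces the function to
  vanish.\<close>

lemma haar_expansion:
  assumes "n \<le> m" and n: "n \<ge> 1" and "step_fun m u" and "mean_zero n u"
  shows "\<exists>c. \<forall>x\<in>{0..<1}. u x = (\<Sum>j\<in>{n<..m}. c j * h j x)"
  using assms(1,3,4)
proof (induction m arbitrary: u rule: dec_induct)
  case base
  have "u x = 0" if x: "x \<in> {0..<1}" for x
  proof -
    obtain A where A: "A \<in> \<A> n" "x \<in> A" using atom_cover[OF n x] by blast
    obtain a b where ab: "a < b" "A = {a..<b}" using atom_interval[OF n A(1)] by blast
    have eq: "indicator A y * u y = indicator {a..<b} y * u x" for y
      using step_fun_eq[OF base(1) A(1) _ A(2), of y] ab by (cases "y \<in> A") auto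
    have "0 = (\<integral>y. indicator A y * u y \<partial>unit_lebesgue)"
      using base(2) A unfolding mean_zero_def by simp
    also have "\<dots> = (b - a) * u x"
      unfolding eq using ab atom_subset[OF n A(1)] by (intro integral_indicator_interval) auto
    finally show ?thesis using ab by simp
  qed
  then show ?case by simp
next
  case (step m)
  have m: "m \<ge> 1" using step n by simp
  have hs: "step_fun (Suc m) (h (Suc m))" by (rule step_fun_h) auto
  define k where "k = (u (\<gamma> m) - u (\<alpha> m)) / (h (Suc m) (\<gamma> m) - h (Suc m) (\<alpha> m))"
  define v where "v = (\<lambda>x. u x - k * h (Suc m) x)"
  have vs: "step_fun (Suc m) v"
    unfolding v_def by (rule step_fun_compose2[OF step(4) hs, of "\<lambda>a b. a - k * b"])
  have "k * (h (Suc m) (\<gamma> m) - h (Suc m) (\<alpha> m)) = u (\<gamma> m) - u (\<alpha> m)"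
    using h_halves_neq[OF m] by (simp add: k_def)
  then have veq: "v (\<gamma> m) = v (\<alpha> m)" unfolding v_def by (simp add: algebra_simps)
  have vm: "step_fun m v"
  proof (rule step_funI)
    fix A x y assume A: "A \<in> \<A> m" "x \<in> A" "y \<in> A"
    show "v x = v y"
    proof (cases "A = {\<alpha> m..<\<beta> m}")
      case True
      have "v z = v (\<alpha> m)" if "z \<in> A" for z
        using step_fun_on_halves[OF m vs, of z] veq that True by (cases "z < \<gamma> m") auto
      then show ?thesis using A by simp
    next
      case False
      then have "A \<in> \<A> (Suc m)" using A by (simp add: atoms_Suc[OF m])
      then show ?thesis using step_fun_eq[OF vs] A by blast
    qed
  qed
  have "mean_zero n v"
    unfolding mean_zero_def
  proof
    fix A assume A: "A \<in> \<A> n"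
    have I: "step_fun m (indicator A :: real \<Rightarrow> real)"
      by (rule step_fun_mono[OF step(1) n step_fun_indicator_atom[OF n A]])
    have int: "integrable unit_lebesgue (\<lambda>x. indicator A x * u x)"
      "integrable unit_lebesgue (\<lambda>x. k * (indicator A x * h (Suc m) x))"
      by (rule step_fun_integrable[OF _ step_fun_mult[OF step_fun_Suc[OF m I] step(4)]]
          step_fun_integrable[OF _ step_fun_mult[OF step_fun_const step_fun_mult[OF step_fun_Suc[OF m I] hs]]]; simp)+
    have "(\<integral>x. indicator A x * v x \<partial>unit_lebesgue) =
      (\<integral>x. indicator A x * u x - k * (indicator A x * h (Suc m) x) \<partial>unit_lebesgue)"
      by (simp add: v_def algebra_simps)
    also have "\<dots> = (\<integral>x. indicator A x * u x \<partial>unit_lebesgue) - k * (\<integral>x. indicator A x * h (Suc m) x \<partial>unit_lebesgue)"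
      using int by simp
    finally show "(\<integral>x. indicator A x * v x \<partial>unit_lebesgue) = 0"
      using integral_step_h[OF m I] step(5) A unfolding mean_zero_def by simp
  qed
  then obtain c where c: "\<forall>x\<in>{0..<1}. v x = (\<Sum>j\<in>{n<..m}. c j * h j x)"
    using step(3)[OF vm] by blast
  have "u x = (\<Sum>j\<in>{n<..Suc m}. (c(Suc m := k)) j * h j x)" if x: "x \<in> {0..<1}" for x
  proof -
    have "{n<..Suc m} = insert (Suc m) {n<..m}" using step(1) by auto
    then have "(\<Sum>j\<in>{n<..Suc m}. (c(Suc m := k)) j * h j x) = k * h (Suc m) x + (\<Sum>j\<in>{n<..m}. (c(Suc m := k)) j * h j x)"
      by simp
    also have "(\<Sum>j\<in>{n<..m}. (c(Suc m := k)) j * h j x) = v x"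
      using c x by (auto intro!: sum.cong)
    finally show ?thesis by (simp add: v_def)
  qed
  then show ?case by blast
qed

section \<open>Blocks with large positive part\<close>

text \<open>The cut is the left end of the level-m atom containing the midpoint, so both pieces are
  unions of level-m atoms. It lies at most one sixth of the length from the midpoint, and 1/2 - 1/6
  = 1/3.\<close>

lemma exists_near_middle_cut:
  assumes n: "n \<ge> 1" and m: "m \<ge> n" and A: "{a..<b} \<in> \<A> n" "a < b"
    and small: "\<And>C. C \<in> \<A> m \<Longrightarrow> measure lebesgue C \<le> (b - a) / 6"
  shows "\<exists>e. (b - a) / 3 \<le> e - a \<and> (b - a) / 3 \<le> b - e \<and>
    step_fun m (indicator {a..<e} :: real \<Rightarrow> real) \<and> step_fun m (indicator {e..<b} :: real \<Rightarrow> real)"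
proof -
  have m1: "m \<ge> 1" using n m by simp
  define z where "z = (a + b) / 2"
  have "z \<in> {a..<b}" using A by (simp add: z_def)
  then have "z \<in> {0..<1}" using atom_subset[OF n A(1)] by blast
  then obtain C where C: "C \<in> \<A> m" "z \<in> C" using atom_cover[OF m1] by blast
  obtain e d where ed: "e < d" "C = {e..<d}" using atom_interval[OF m1 C(1)] by blast
  have "d - e \<le> (b - a) / 6" using small[OF C(1)] ed by simp
  then have e: "(b - a) / 3 \<le> e - a" "(b - a) / 3 \<le> b - e"
    using C(2) ed A(2) by (auto simp: z_def field_simps)
  have I: "step_fun m (indicator {a..<b} :: real \<Rightarrow> real)"
    by (rule step_fun_mono[OF m n step_fun_indicator_atom[OF n A(1)]])
  have side: "x < e \<longleftrightarrow> y < e" if B: "B \<in> \<A> m" "x \<in> B" "y \<in> B" for B x y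
  proof -
    obtain p q where pq: "p < q" "B = {p..<q}" using atom_interval[OF m1 B(1)] by blast
    show ?thesis
    proof (cases "B = C")
      case False
      then have "e \<notin> B" using atom_unique[OF m1 B(1) C(1), of e] ed by auto
      then show ?thesis using B pq by auto
    qed (use B ed in auto)
  qed
  have AB: "x \<in> {a..<b} \<longleftrightarrow> y \<in> {a..<b}" if B: "B \<in> \<A> m" "x \<in> B" "y \<in> B" for B x y
    using step_fun_eq[OF I B] by (auto simp: indicator_def split: if_splits)
  have "step_fun m (indicator {a..<e} :: real \<Rightarrow> real)"
  proof (rule step_funI)
    fix B x y assume "B \<in> \<A> m" "x \<in> B" "y \<in> B"
    note B = this
    have "x \<in> {a..<e} \<longleftrightarrow> y \<in> {a..<e}" using side[OF B] AB[OF B] e A(2) by auto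
    then show "(indicator {a..<e} x :: real) = indicator {a..<e} y" by (simp add: indicator_def)
  qed
  moreover have "step_fun m (indicator {e..<b} :: real \<Rightarrow> real)"
  proof (rule step_funI)
    fix B x y assume "B \<in> \<A> m" "x \<in> B" "y \<in> B"
    note B = this
    have "x \<in> {e..<b} \<longleftrightarrow> y \<in> {e..<b}" using side[OF B] AB[OF B] e A(2) by auto
    then show "(indicator {e..<b} x :: real) = indicator {e..<b} y" by (simp add: indicator_def)
  qed
  ultimately show ?thesis using e by blast
qed

lemma eventually_atoms_small:
  assumes "\<delta> > 0"
  shows "\<exists>m>n. \<forall>C\<in>\<A> m. measure lebesgue C \<le> \<delta>"
proof -
  have "eventually (\<lambda>m. (MAX A\<in>\<A> m. measure lebesgue A) < \<delta>) sequentially"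
    using mesh assms by (rule order_tendstoD)
  then have "eventually (\<lambda>m. (MAX A\<in>\<A> m. measure lebesgue A) < \<delta> \<and> m > n \<and> m \<ge> 1) sequentially"
    by (intro eventually_conj eventually_gt_at_top eventually_ge_at_top)
  then obtain m where m: "(MAX A\<in>\<A> m. measure lebesgue A) < \<delta>" "m > n" "m \<ge> 1"
    using eventually_happens'[OF sequentially_bot] by blast
  have "measure lebesgue C \<le> \<delta>" if "C \<in> \<A> m" for C
  proof -
    have "measure lebesgue C \<le> (MAX A\<in>\<A> m. measure lebesgue A)"
      using finite_atoms[OF m(3)] that by (intro Max_ge) auto
    then show ?thesis using m by simp
  qed
  then show ?thesis using m by blast
qed

text \<open>Each atom [a,b) of level n is cut at some e near its middle; g is -(b-e)/(b-a) on the
  left piece and (e-a)/(b-a) on the right one, which balances its mean. The positive part has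
  integral (b-e)(e-a)/(b-a), at least 2/9 of the length.\<close>

lemma exists_block:
  assumes n: "n \<ge> 1"
  shows "\<exists>m g. m > n \<and> step_fun m g \<and> (\<forall>x. \<bar>g x\<bar> \<le> 1) \<and> mean_zero n g \<and>
    (\<integral>x. max 0 (g x) \<partial>unit_lebesgue) \<ge> 2/9"
proof -
  have fin: "finite (\<A> n)" by (rule finite_atoms[OF n])
  have pos: "measure lebesgue A > 0" if "A \<in> \<A> n" for A
    using atom_interval[OF n that] by auto
  \<comment> \<open>One sixth of the smallest atom: a single finer level m then serves every atom of
    level n.\<close>
  define \<delta> where "\<delta> = Min ((\<lambda>A. measure lebesgue A / 6) ` \<A> n)"
  have "\<A> n \<noteq> {}" using split_atom[OF n] by blast
  then have "\<delta> > 0" unfolding \<delta>_def using fin pos by (subst Min_gr_iff) auto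
  then obtain m where m: "m > n" "\<And>C. C \<in> \<A> m \<Longrightarrow> measure lebesgue C \<le> \<delta>"
    using eventually_atoms_small by blast
  have m1: "m \<ge> 1" using m n by simp
  define P where "P A a e b \<longleftrightarrow> A = {a..<b} \<and> a < b \<and> (b - a) / 3 \<le> e - a \<and> (b - a) / 3 \<le> b - e \<and>
    step_fun m (indicator {a..<e} :: real \<Rightarrow> real) \<and> step_fun m (indicator {e..<b} :: real \<Rightarrow> real)"
    for A a e b
  have "\<exists>a e b. P A a e b" if A: "A \<in> \<A> n" for A
  proof -
    obtain a b where ab: "a < b" "A = {a..<b}" using atom_interval[OF n A] by blast
    have "\<delta> \<le> measure lebesgue A / 6" unfolding \<delta>_def using fin A by (intro Min_le) auto
    then have "measure lebesgue C \<le> (b - a) / 6" if "C \<in> \<A> m" for C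
      using m(2)[OF that] ab by simp
    then show ?thesis
      using exists_near_middle_cut[OF n less_imp_le[OF m(1)], of a b] A ab unfolding P_def by blast
  qed
  then obtain a e b where aeb: "\<And>A. A \<in> \<A> n \<Longrightarrow> P A (a A) (e A) (b A)" by metis
  have A: "A = {a A..<b A}" "a A < b A" "(b A - a A) / 3 \<le> e A - a A" "(b A - a A) / 3 \<le> b A - e A"
    "a A < e A" "e A < b A"
    "step_fun m (indicator {a A..<e A} :: real \<Rightarrow> real)" "step_fun m (indicator {e A..<b A} :: real \<Rightarrow> real)"
    if "A \<in> \<A> n" for A
  proof -
    note p = aeb[OF that, unfolded P_def]
    show "A = {a A..<b A}" "a A < b A" "(b A - a A) / 3 \<le> e A - a A" "(b A - a A) / 3 \<le> b A - e A"
      "step_fun m (indicator {a A..<e A} :: real \<Rightarrow> real)" "step_fun m (indicator {e A..<b A} :: real \<Rightarrow> real)"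
      using p by blast+
    have "(b A - a A) / 3 > 0" using p by simp
    moreover have "(b A - a A) / 3 \<le> e A - a A" "(b A - a A) / 3 \<le> b A - e A" using p by blast+
    ultimately show "a A < e A" "e A < b A" by linarith+
  qed
  have sub: "{a A..<e A} \<subseteq> {0..<1}" "{e A..<b A} \<subseteq> {0..<1}" if "A \<in> \<A> n" for A
  proof -
    have "{a A..<b A} \<subseteq> {0..<1}" using A(1)[OF that] atom_subset[OF n that] by simp
    then show "{a A..<e A} \<subseteq> {0..<1}" "{e A..<b A} \<subseteq> {0..<1}"
      using A(5,6)[OF that] by (auto simp: subset_iff)
  qed
  define k where "k A = (e A - a A) / (b A - a A)" for A
  define l where "l A = (b A - e A) / (b A - a A)" for A
  define G where "G A x = k A * indicator {e A..<b A} x - l A * indicator {a A..<e A} x" for A and x :: real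
  define g where "g x = (\<Sum>A\<in>\<A> n. G A x)" for x
  have kl: "0 \<le> k A" "k A \<le> 1" "0 \<le> l A" "l A \<le> 1" if "A \<in> \<A> n" for A
    using A(2,5,6)[OF that] by (auto simp: k_def l_def)
  have G1: "\<bar>G A x\<bar> \<le> 1" if "A \<in> \<A> n" for A x
    using kl[OF that] by (auto simp: G_def indicator_def)
  have G0: "G A x = 0" if "A \<in> \<A> n" "x \<notin> A" for A x
  proof -
    have "x \<notin> {a A..<b A}" using A(1)[OF that(1)] that(2) by simp
    then have "x \<notin> {e A..<b A}" "x \<notin> {a A..<e A}" using A(5,6)[OF that(1)] by auto
    then show ?thesis by (simp add: G_def)
  qed
  have gG: "g x = G A x" if "A \<in> \<A> n" "x \<in> A" for A x
  proof -
    have "g x = (\<Sum>B\<in>\<A> n. if B = A then G A x else 0)"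
      unfolding g_def
    proof (intro sum.cong refl)
      fix B assume B: "B \<in> \<A> n"
      then have "x \<notin> B" if "B \<noteq> A" using that atom_unique[OF n _ _ _ \<open>x \<in> A\<close>] \<open>A \<in> \<A> n\<close> by blast
      then show "G B x = (if B = A then G A x else 0)" using G0[OF B] by auto
    qed
    then show ?thesis using that fin by simp
  qed
  have "\<bar>g x\<bar> \<le> 1" for x
  proof (cases "\<exists>A\<in>\<A> n. x \<in> A")
    case True
    then show ?thesis using gG G1 by metis
  next
    case False
    then have "g x = 0" unfolding g_def using G0 by (intro sum.neutral) blast
    then show ?thesis by simp
  qed
  moreover have gs: "step_fun m g"
    unfolding g_def G_def
    using A(7,8) by (intro step_fun_sum step_fun_compose2[where \<phi> = "\<lambda>u v. k _ * u - l _ * v"]) auto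
  moreover have "mean_zero n g"
    unfolding mean_zero_def
  proof
    fix B assume B: "B \<in> \<A> n"
    have i: "integrable unit_lebesgue (\<lambda>x. indicator {e B..<b B} x * k B)"
      "integrable unit_lebesgue (\<lambda>x. indicator {a B..<e B} x * l B)"
      by (rule step_fun_integrable[OF m1 step_fun_mult[OF A(8)[OF B] step_fun_const]]
          step_fun_integrable[OF m1 step_fun_mult[OF A(7)[OF B] step_fun_const]])+
    have "indicator B x * g x = indicator {e B..<b B} x * k B - indicator {a B..<e B} x * l B" for x
      using gG[OF B, of x] G0[OF B, of x] by (cases "x \<in> B") (simp_all add: G_def mult.commute)
    then have "(\<integral>x. indicator B x * g x \<partial>unit_lebesgue) =
      (\<integral>x. indicator {e B..<b B} x * k B \<partial>unit_lebesgue) - (\<integral>x. indicator {a B..<e B} x * l B \<partial>unit_lebesgue)"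
      using i by (simp only:) (rule Bochner_Integration.integral_diff)
    also have "\<dots> = (b B - e B) * k B - (e B - a B) * l B"
      using A(5,6)[OF B] sub[OF B] by (simp only: integral_indicator_interval less_imp_le)
    also have "\<dots> = 0" by (simp add: k_def l_def)
    finally show "(\<integral>x. indicator B x * g x \<partial>unit_lebesgue) = 0" .
  qed
  moreover have "(\<integral>x. max 0 (g x) \<partial>unit_lebesgue) \<ge> 2/9"
  proof -
    have i: "integrable unit_lebesgue (\<lambda>x. indicator {e B..<b B} x * k B)" if "B \<in> \<A> n" for B
      by (rule step_fun_integrable[OF m1 step_fun_mult[OF A(8)[OF that] step_fun_const]])
    have "(1::real) = (\<integral>x. (\<Sum>A\<in>\<A> n. indicator A x) \<partial>unit_lebesgue)"
    proof -
      have "(\<integral>x. (\<Sum>A\<in>\<A> n. indicator A x) \<partial>unit_lebesgue) = (\<integral>x. (1::real) \<partial>unit_lebesgue)"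
      proof (intro Bochner_Integration.integral_cong refl)
        fix x :: real assume "x \<in> space unit_lebesgue"
        then have "x \<in> {0..<1}" by simp
        then obtain A where A: "A \<in> \<A> n" "x \<in> A" using atom_cover[OF n] by blast
        have "(\<Sum>B\<in>\<A> n. indicator B x) = (\<Sum>B\<in>\<A> n. if B = A then 1 else (0::real))"
          using A atom_unique[OF n] by (intro sum.cong) (auto simp: indicator_def)
        then show "(\<Sum>B\<in>\<A> n. indicator B x) = (1::real)" using A fin by simp
      qed
      then show ?thesis by (simp add: measure_restrict_space)
    qed
    also have "\<dots> = (\<Sum>A\<in>\<A> n. b A - a A)"
    proof (subst Bochner_Integration.integral_sum)
      show "integrable unit_lebesgue (indicator A :: real \<Rightarrow> real)" if "A \<in> \<A> n" for A
        by (rule step_fun_integrable[OF n step_fun_indicator_atom[OF n that]])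
      show "(\<Sum>A\<in>\<A> n. \<integral>x. indicator A x \<partial>unit_lebesgue) = (\<Sum>A\<in>\<A> n. b A - a A)"
      proof (intro sum.cong refl)
        fix B assume B: "B \<in> \<A> n"
        show "(\<integral>x. indicator B x \<partial>unit_lebesgue) = b B - a B"
          using integral_indicator_interval[of "a B" "b B" 1] A(1,2)[OF B] atom_subset[OF n B] by simp
      qed
    qed
    finally have one: "(\<Sum>A\<in>\<A> n. b A - a A) = 1" by simp
    have "2/9 = (\<Sum>A\<in>\<A> n. 2/9 * (b A - a A))"
      by (simp only: sum_distrib_left[symmetric] one mult_1_right)
    also have "\<dots> \<le> (\<Sum>A\<in>\<A> n. (b A - e A) * k A)"
    proof (intro sum_mono)
      fix B assume B: "B \<in> \<A> n"
      \<comment> \<open>With p = (e-a)/(b-a) and up to the factor (b-a)^2, this is (p - 1/3)(1 - p -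
        1/3) >= 0, that is, p (1 - p) >= 2/9.\<close>
      have "0 \<le> ((e B - a B) - (b B - a B)/3) * ((b B - e B) - (b B - a B)/3)"
        using A(3,4)[OF B] by (intro mult_nonneg_nonneg) auto
      then have "2/9 * (b B - a B) * (b B - a B) \<le> (b B - e B) * (e B - a B)"
        by (simp add: field_simps)
      then show "2/9 * (b B - a B) \<le> (b B - e B) * k B"
        using A(2)[OF B] by (simp add: k_def pos_le_divide_eq)
    qed
    also have "\<dots> = (\<Sum>B\<in>\<A> n. \<integral>x. indicator {e B..<b B} x * k B \<partial>unit_lebesgue)"
      using A(6) sub(2) by (intro sum.cong refl) (simp only: integral_indicator_interval less_imp_le)
    also have "\<dots> = (\<integral>x. (\<Sum>B\<in>\<A> n. indicator {e B..<b B} x * k B) \<partial>unit_lebesgue)"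
      using i by (intro Bochner_Integration.integral_sum[symmetric])
    also have "\<dots> \<le> (\<integral>x. max 0 (g x) \<partial>unit_lebesgue)"
    proof (intro integral_mono Bochner_Integration.integrable_sum i)
      show "integrable unit_lebesgue (\<lambda>x. max 0 (g x))"
        by (rule step_fun_integrable[OF m1 step_fun_compose[OF gs]])
      fix x :: real assume "x \<in> space unit_lebesgue"
      then have "x \<in> {0..<1}" by simp
      then obtain B where B: "B \<in> \<A> n" "x \<in> B" using atom_cover[OF n] by blast
      have "(\<Sum>C\<in>\<A> n. indicator {e C..<b C} x * k C) = (\<Sum>C\<in>\<A> n. if C = B then indicator {e B..<b B} x * k B else 0)"
      proof (intro sum.cong refl)
        fix C assume C: "C \<in> \<A> n"
        have "x \<notin> {e C..<b C}" if "C \<noteq> B"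
        proof
          assume "x \<in> {e C..<b C}"
          then have "x \<in> {a C..<b C}" using A(5)[OF C] by simp
          then have "x \<in> C" using A(1)[OF C] by simp
          then show False using that atom_unique[OF n C B(1) _ B(2)] by blast
        qed
        then show "indicator {e C..<b C} x * k C = (if C = B then indicator {e B..<b B} x * k B else 0)" by auto
      qed
      also have "\<dots> = indicator {e B..<b B} x * k B" using B fin by simp
      also have "\<dots> \<le> max 0 (g x)"
        using gG[OF B] by (auto simp: G_def indicator_def)
      finally show "(\<Sum>C\<in>\<A> n. indicator {e C..<b C} x * k C) \<le> max 0 (g x)" .
    qed
    finally show ?thesis .
  qed
  ultimately show ?thesis using m(1) by blast
qed

text \<open>The block construction is iterated from level 1. By the expansion above, the l-th block
  uses only \<open>h j\<close> with \<open>N l < j \<le> N (Suc l)\<close>, so different blocks use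
  disjoint sets of Haar functions.\<close>

lemma exists_block_sequence:
  obtains N :: "nat \<Rightarrow> nat" and g where "N 0 = 1" "strict_mono N"
    "\<And>l. step_fun (N (Suc l)) (g l)" "\<And>l x. \<bar>g l x\<bar> \<le> 1" "\<And>l. mean_zero (N l) (g l)"
    "\<And>l. (\<integral>x. max 0 (g l x) \<partial>unit_lebesgue) \<ge> 2/9"
proof -
  define P where "P n m g \<longleftrightarrow> m > n \<and> step_fun m g \<and> (\<forall>x. \<bar>g x\<bar> \<le> 1) \<and> mean_zero n g \<and>
    (\<integral>x. max 0 (g x) \<partial>unit_lebesgue) \<ge> 2/9" for n m and g :: "real \<Rightarrow> real"
  have "\<exists>m g. P n m g" if "n \<ge> 1" for n
    using exists_block[OF that] unfolding P_def .
  then obtain M k where M: "\<And>n. n \<ge> 1 \<Longrightarrow> P n (M n) (k n)" by metis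
  define N where "N l = (M ^^ l) 1" for l
  have N1: "N l \<ge> 1" for l
  proof (induction l)
    case (Suc l)
    then show ?case using M[OF Suc] by (simp add: N_def P_def)
  qed (simp add: N_def)
  have P: "P (N l) (N (Suc l)) (k (N l))" for l
    using M[OF N1[of l]] by (simp add: N_def)
  show ?thesis
  proof (rule that[of N "\<lambda>l. k (N l)"])
    show "strict_mono N" using P by (simp add: strict_mono_Suc_iff P_def)
  qed (use P in \<open>simp_all add: N_def P_def\<close>)
qed

lemma integral_block_sq:
  assumes "m \<ge> 1"
  shows "(\<integral>x. (\<Sum>j\<in>{n<..m}. c j * h j x)\<^sup>2 \<partial>unit_lebesgue) = (\<Sum>j\<in>{n<..m}. (c j)\<^sup>2)"
proof -
  define e where "e j = (if n < j then c j else 0)" for j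
  have "(\<Sum>j\<in>{n<..m}. c j * h j x) = haar_sum e m x" for x
    unfolding haar_sum_def by (rule sum.mono_neutral_cong_left) (auto simp: e_def)
  moreover have "(\<Sum>j\<in>{n<..m}. (c j)\<^sup>2) = (\<Sum>j=1..m. (e j)\<^sup>2)"
    by (rule sum.mono_neutral_cong_left) (auto simp: e_def)
  ultimately show ?thesis using integral_haar_sum_sq[OF assms] by simp
qed

section \<open>Summation in the in-order of the sign tree\<close>

lemma maximal_function_lower:
  assumes r: "r \<ge> 1" and n: "2 ^ r \<le> n"
  shows "\<exists>p\<in>monotonic_polynomials h n.
    2/9 * sqrt r \<le> L2_norm (\<lambda>x. MAX m\<in>{1..n}. \<bar>p m x\<bar>) / L2_norm (p n)"
proof -
  obtain N :: "nat \<Rightarrow> nat" and g where N0: "N 0 = 1" and Nmono: "strict_mono N"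
    and gstep: "\<And>l. step_fun (N (Suc l)) (g l)" and g1: "\<And>l x. \<bar>g l x\<bar> \<le> 1"
    and gmean: "\<And>l. mean_zero (N l) (g l)"
    and gpos: "\<And>l. (\<integral>x. max 0 (g l x) \<partial>unit_lebesgue) \<ge> 2/9"
    using exists_block_sequence by blast
  have Nle: "N i \<le> N j" if "i \<le> j" for i j using Nmono that by (simp add: strict_mono_less_eq)
  have N1: "N l \<ge> 1" for l using Nle[of 0 l] N0 by simp
  have "\<exists>c. \<forall>x\<in>{0..<1}. g l x = (\<Sum>j\<in>{N l<..N (Suc l)}. c j * h j x)" for l
    by (rule haar_expansion[OF Nle N1 gstep gmean]) simp
  then obtain c where c: "\<And>l x. x \<in> {0..<1} \<Longrightarrow> g l x = (\<Sum>j\<in>{N l<..N (Suc l)}. c l j * h j x)"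
    by metis
  \<comment> \<open>The block containing j; it merges the separate block expansions into one
    coefficient sequence C.\<close>
  define lev where "lev j = (LEAST l. j \<le> N (Suc l))" for j
  have lev: "lev j = l" if "j \<in> {N l<..N (Suc l)}" for j l
    unfolding lev_def
  proof (rule Least_equality)
    fix y assume "j \<le> N (Suc y)"
    then have "\<not> N (Suc y) \<le> N l" using that by simp
    then show "l \<le> y" using Nle[of "Suc y" l] by linarith
  qed (use that in simp)
  define C where "C j = c (lev j) j" for j
  have gC: "g l x = (\<Sum>j\<in>{N l<..N (Suc l)}. C j * h j x)" if "x \<in> {0..<1}" for l x
    unfolding c[OF that] C_def using lev by (intro sum.cong) auto
  \<comment> \<open>The digits record the path of x. Zeros of \<open>g i\<close> may share the digit
    0 with negative values, since the positive part vanishes at both.\<close>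
  define \<epsilon> where "\<epsilon> x i = (if g i x > 0 then 1 else 0 :: nat)" for x i
  define addr where "addr l x = (\<Sum>i<l. \<epsilon> x i * 2 ^ (r - 1 - i))" for l x
  \<comment> \<open>the position in the in-order traversal of the tree node to which \<open>h j\<close> belongs\<close>
  define \<kappa> where "\<kappa> j = addr (lev j) (\<alpha> (j - 1)) + 2 ^ (r - 1 - lev j)" for j
  have eps1: "\<epsilon> x i \<le> 1" for x i by (simp add: \<epsilon>_def)
  have addr_step: "step_fun (N l) (addr l)" for l
  proof (rule step_funI)
    fix A x y assume A: "A \<in> \<A> (N l)" "x \<in> A" "y \<in> A"
    have "g i x = g i y" if "i < l" for i
      using step_fun_eq[OF step_fun_mono[OF Nle N1 gstep] A, of i] that by simp
    then show "addr l x = addr l y" unfolding addr_def \<epsilon>_def by (intro sum.cong) auto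
  qed
  \<comment> \<open>The split interval carrying \<open>h j\<close> is an atom of level j - 1 >= N l,
    on which the first l signs are constant; the key may be read off at any of its points.\<close>
  have key: "\<kappa> j = addr l x + 2 ^ (r - 1 - l)"
    if "j \<in> {N l<..N (Suc l)}" "x \<in> {\<alpha> (j - 1)..<\<beta> (j - 1)}" for j l x
  proof -
    have j: "N l \<le> j - 1" "1 \<le> j - 1" using that(1) N1[of l] by auto
    have "addr l x = addr l (\<alpha> (j - 1))"
      by (rule step_fun_on_split[OF j(2) step_fun_mono[OF j(1) N1 addr_step] that(2)])
    then show ?thesis by (simp add: \<kappa>_def lev[OF that(1)])
  qed
  \<comment> \<open>The clause \<open>k = n\<close> makes the last polynomial the full sum without a
    bound on the keys; it does not interfere at the addresses, which lie below n.\<close>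
  define G where "G k = {j\<in>{N 0<..N r}. \<kappa> j \<le> k \<or> k = n}" for k
  define q where "q k x = (\<Sum>j\<in>G k. C j * h j x)" for k x
  define D where "D = (\<Sum>j\<in>G n. (C j)\<^sup>2)"
  have Gn: "G n = {N 0<..N r}" by (auto simp: G_def)
  have addr_less: "addr r x < n" for x
    using binary_tail_less[of "\<epsilon> x" 0 r] eps1 n by (simp add: addr_def lessThan_atLeast0)
  have diagonal: "q (addr r x) x = (\<Sum>l<r. max 0 (g l x))" if x: "x \<in> {0..<1}" for x
  proof -
    have "q (addr r x) x = (\<Sum>j\<in>{N 0<..N r}. if \<kappa> j \<le> addr r x then C j * h j x else 0)"
    proof -
      have "G (addr r x) = {j\<in>{N 0<..N r}. \<kappa> j \<le> addr r x}"
        using addr_less[of x] by (auto simp: G_def)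
      then show ?thesis by (simp only: q_def sum.inter_filter[OF finite_greaterThanAtMost])
    qed
    also have "\<dots> = (\<Sum>l<r. \<Sum>j\<in>{N l<..N (Suc l)}. if \<kappa> j \<le> addr r x then C j * h j x else 0)"
      using Nle by (intro sum_blocks monoI)
    \<comment> \<open>Where \<open>h j x\<close> can be nonzero, the condition on the key depends
      only on the block: block l is summed entirely or omitted entirely, according to the sign of
      \<open>g l x\<close>.\<close>
    also have "\<dots> = (\<Sum>l<r. \<Sum>j\<in>{N l<..N (Suc l)}. if \<epsilon> x l = 1 then C j * h j x else 0)"
    proof (intro sum.cong refl)
      fix l j assume l: "l \<in> {..<r}" and j: "j \<in> {N l<..N (Suc l)}"
      show "(if \<kappa> j \<le> addr r x then C j * h j x else 0) = (if \<epsilon> x l = 1 then C j * h j x else 0)"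
      proof (cases "x \<in> {\<alpha> (j - 1)..<\<beta> (j - 1)}")
        case True
        have "\<kappa> j \<le> addr r x \<longleftrightarrow> \<epsilon> x l = 1"
          unfolding key[OF j True] unfolding addr_def
          using l by (intro in_order_key_le_iff eps1) auto
        then show ?thesis by simp
      next
        case False
        have "1 \<le> j - 1" "Suc (j - 1) = j" using j N1[of l] by auto
        then have "h j x = 0" using h_off_split[OF _ x False] by simp
        then show ?thesis by simp
      qed
    qed
    also have "\<dots> = (\<Sum>l<r. if \<epsilon> x l = 1 then g l x else 0)"
      unfolding gC[OF x] by (intro sum.cong) auto
    also have "\<dots> = (\<Sum>l<r. max 0 (g l x))"
      by (intro sum.cong) (auto simp: \<epsilon>_def)
    finally show ?thesis .
  qed
  define S where "S x = (\<Sum>l<r. max 0 (g l x))" for x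
  define M where "M x = (MAX m\<in>{1..n}. \<bar>q m x\<bar>)" for x
  have n1: "n \<ge> 1" using n by (meson one_le_numeral one_le_power order_trans)
  have S0: "S x \<ge> 0" for x unfolding S_def by (intro sum_nonneg) auto
  have qM: "\<bar>q m x\<bar> \<le> M x" if "m \<in> {1..n}" for m x
    unfolding M_def using that by (intro Max_ge) auto
  have SM: "S x \<le> M x" if x: "x \<in> {0..<1}" for x
  proof (cases "addr r x = 0")
    case True
    \<comment> \<open>Address 0 lies outside the index range of the maximum. All keys are positive,
      so no term has been added there and the sum of positive parts is 0.\<close>
    have "G 0 = {}" using n1 by (auto simp: G_def \<kappa>_def)
    then have "S x = 0" using diagonal[OF x] True by (simp add: q_def S_def)
    also have "0 \<le> M x" using qM[of 1 x] n1 by simp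
    finally show ?thesis .
  next
    case False
    then have "addr r x \<in> {1..n}" using addr_less[of x] by simp
    then have "\<bar>q (addr r x) x\<bar> \<le> M x" by (rule qM)
    then show ?thesis using diagonal[OF x] by (simp add: S_def)
  qed
  have gstep_r: "step_fun (N r) (\<lambda>x. max 0 (g l x))" if "l < r" for l
    using that by (intro step_fun_mono[OF _ N1 step_fun_compose[OF gstep]] Nle) auto
  have Sint: "integrable unit_lebesgue S"
    unfolding S_def by (intro step_fun_integrable[OF N1[of r]] step_fun_sum gstep_r) auto
  have qstep: "step_fun (N r) (q k)" for k
    unfolding q_def using N0
    by (intro step_fun_sum step_fun_mult[OF step_fun_const] step_fun_h) (auto simp: G_def)
  have "step_fun (N r) M"
  proof (rule step_funI)
    fix A x y assume A: "A \<in> \<A> (N r)" "x \<in> A" "y \<in> A"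
    show "M x = M y" unfolding M_def using step_fun_eq[OF qstep A] by simp
  qed
  then have Mint: "integrable unit_lebesgue (\<lambda>x. (M x)\<^sup>2)"
    by (intro step_fun_integrable[OF N1[of r]] step_fun_power)
  \<comment> \<open>A lower bound for the mean of S. Integrating S^2 >= 2 t S - t^2 turns it into
    the lower bound t^2 for the integral of M^2.\<close>
  define t where "t = 2/9 * real r"
  have t0: "t \<ge> 0" by (simp add: t_def)
  have "t \<le> (\<integral>x. S x \<partial>unit_lebesgue)"
  proof -
    have "t = (\<Sum>l<r. 2/9)" by (simp add: t_def)
    also have "\<dots> \<le> (\<Sum>l<r. \<integral>x. max 0 (g l x) \<partial>unit_lebesgue)"
      by (intro sum_mono gpos)
    also have "\<dots> = (\<integral>x. S x \<partial>unit_lebesgue)"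
      unfolding S_def using step_fun_integrable[OF N1 gstep_r]
      by (intro Bochner_Integration.integral_sum[symmetric]) auto
    finally show ?thesis .
  qed
  then have "t * t \<le> t * (\<integral>x. S x \<partial>unit_lebesgue)" using t0 by (intro mult_left_mono)
  then have "t\<^sup>2 \<le> 2 * t * (\<integral>x. S x \<partial>unit_lebesgue) - t\<^sup>2" by (simp add: power2_eq_square)
  also have "\<dots> = (\<integral>x. 2 * t * S x \<partial>unit_lebesgue) - (\<integral>x. t\<^sup>2 \<partial>unit_lebesgue)"
    by (simp add: measure_restrict_space)
  also have "\<dots> = (\<integral>x. 2 * t * S x - t\<^sup>2 \<partial>unit_lebesgue)"
    using Sint step_fun_integrable[OF N1 step_fun_const]
    by (intro Bochner_Integration.integral_diff[symmetric]) auto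
  also have "\<dots> \<le> (\<integral>x. (M x)\<^sup>2 \<partial>unit_lebesgue)"
  proof (intro integral_mono Mint Bochner_Integration.integrable_diff step_fun_integrable[OF N1 step_fun_const])
    show "integrable unit_lebesgue (\<lambda>x. 2 * t * S x)" using Sint by simp
    fix x :: real assume "x \<in> space unit_lebesgue"
    then have x: "x \<in> {0..<1}" by simp
    have "2 * t * S x - t\<^sup>2 \<le> (S x)\<^sup>2"
      using zero_le_power2[of "S x - t"] by (simp add: power2_eq_square algebra_simps)
    also have "\<dots> \<le> (M x)\<^sup>2" using SM[OF x] S0 by (intro power_mono)
    finally show "2 * t * S x - t\<^sup>2 \<le> (M x)\<^sup>2" .
  qed
  finally have "sqrt (t\<^sup>2) \<le> sqrt (\<integral>x. (M x)\<^sup>2 \<partial>unit_lebesgue)" by (rule real_sqrt_le_mono)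
  then have normM: "t \<le> L2_norm M" using t0 by (simp add: L2_norm_def)
  have block: "(\<integral>x. (g l x)\<^sup>2 \<partial>unit_lebesgue) = (\<Sum>j\<in>{N l<..N (Suc l)}. (C j)\<^sup>2)" for l
  proof -
    have "(\<integral>x. (g l x)\<^sup>2 \<partial>unit_lebesgue) = (\<integral>x. (\<Sum>j\<in>{N l<..N (Suc l)}. C j * h j x)\<^sup>2 \<partial>unit_lebesgue)"
      using gC by (intro Bochner_Integration.integral_cong) auto
    then show ?thesis using integral_block_sq[OF N1] by simp
  qed
  have "D = (\<Sum>l<r. \<Sum>j\<in>{N l<..N (Suc l)}. (C j)\<^sup>2)"
    unfolding D_def Gn using Nle by (intro sum_blocks monoI)
  also have "\<dots> \<le> (\<Sum>l<r. 1)"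
  proof (intro sum_mono)
    fix l
    have "(\<integral>x. (g l x)\<^sup>2 \<partial>unit_lebesgue) \<le> (\<integral>x. 1 \<partial>unit_lebesgue)"
      using g1 by (intro integral_mono step_fun_integrable[OF N1 step_fun_const]
          step_fun_integrable[OF N1 step_fun_power[OF gstep]]) (simp add: abs_square_le_1)
    then show "(\<Sum>j\<in>{N l<..N (Suc l)}. (C j)\<^sup>2) \<le> (1::real)"
      using block by (simp add: measure_restrict_space)
  qed
  finally have Dr: "D \<le> r" by simp
  have "D \<noteq> 0"
  \<comment> \<open>If all coefficients vanished, so would \<open>g 0\<close>, whose positive part
    has integral at least 2/9.\<close>
  proof
    assume "D = 0"
    then have C0: "C j = 0" if "j \<in> {N 0<..N r}" for j
      using that unfolding D_def Gn by (simp add: sum_nonneg_eq_0_iff)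
    have "g 0 x = 0" if "x \<in> {0..<1}" for x
      unfolding gC[OF that] using C0 Nle[of "Suc 0" r] r by (intro sum.neutral) auto
    then have "(\<integral>x. max 0 (g 0 x) \<partial>unit_lebesgue) = (\<integral>x. 0 \<partial>unit_lebesgue)"
      by (intro Bochner_Integration.integral_cong) auto
    then show False using gpos[of 0] by simp
  qed
  moreover have "D \<ge> 0" unfolding D_def by (intro sum_nonneg) auto
  ultimately have D: "D > 0" by simp
  have normq: "L2_norm (q n) = sqrt D"
    unfolding L2_norm_def q_def D_def Gn using integral_block_sq[OF N1] by simp
  have "q \<in> monotonic_polynomials h n"
    unfolding monotonic_polynomials_def mem_Collect_eq
  proof (intro exI[of _ G] exI[of _ C] conjI ballI)
    show "G k \<subseteq> G (Suc k)" if "k \<in> {1..<n}" for k using that by (auto simp: G_def)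
    show "(\<Sum>j\<in>G n. (C j)\<^sup>2) \<noteq> 0" using D by (simp add: D_def)
  qed (auto simp: G_def q_def N0)
  moreover have "2/9 * sqrt r \<le> L2_norm M / L2_norm (q n)"
  proof -
    have "real r / sqrt r = sqrt r" by (rule real_div_sqrt) simp
    then have "2/9 * sqrt r = t / sqrt r" by (simp add: t_def)
    also have "\<dots> \<le> L2_norm M / sqrt D" using normM t0 D Dr by (intro frac_le) auto
    finally show ?thesis by (simp add: normq)
  qed
  ultimately show ?thesis unfolding M_def by blast
qed

end

theorem theorem1p2:
  fixes H :: "nat \<Rightarrow> real \<Rightarrow> real"
  assumes "generalized_haar_system H"
  shows "\<exists>c1 c2 :: real. c1 > 0 \<and> c2 > 0 \<and>
    (\<forall>n::nat. n \<ge> 2 \<longrightarrow>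
       ereal (c1 * sqrt (log 2 (real n))) \<le> maximal_constant n H \<and>
       maximal_constant n H \<le> ereal (c2 * sqrt (log 2 (real n))))"
proof -
  obtain \<A> \<alpha> \<gamma> \<beta> where "haar_system \<A> H \<alpha> \<gamma> \<beta>"
    using assms by (rule generalized_haar_system_locale)
  then interpret haar_system \<A> H \<alpha> \<gamma> \<beta> .
  define c2 where "c2 = sqrt (71 + 128 * self_normalized_const)"
  have c2: "c2 > 0" by (simp add: c2_def self_normalized_const_def add_pos_pos)
  show ?thesis
  proof (rule exI[of _ "1/9"], rule exI[of _ c2], intro conjI allI impI)
    fix n :: nat assume n: "n \<ge> 2"
    \<comment> \<open>r is the integer part of log 2 n. As r >= 1, log 2 n < r + 1 <= 4 r, and the
      factor sqrt 4 = 2 turns 2/9 into the constant 1/9.\<close>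
    obtain r where r: "2 ^ r \<le> n" "n < 2 ^ (r + 1)"
      using ex_power_ivl1[of 2 n] n by auto
    have r1: "r \<ge> 1"
      using r n by (cases r) auto
    obtain p where p: "p \<in> monotonic_polynomials H n"
      "2/9 * sqrt r \<le> L2_norm (\<lambda>x. MAX m\<in>{1..n}. \<bar>p m x\<bar>) / L2_norm (p n)"
      using maximal_function_lower[OF r1 r(1)] by blast
    have "log 2 n < real (r + 1)" using n r(2) by (intro log2_of_power_less) auto
    then have "log 2 n \<le> 4 * real r" using r1 by simp
    then have "sqrt (log 2 n) \<le> sqrt (4 * real r)" by (rule real_sqrt_le_mono)
    then have "1/9 * sqrt (log 2 n) \<le> 2/9 * sqrt r" by (simp add: real_sqrt_mult)
    then show "ereal (1/9 * sqrt (log 2 n)) \<le> maximal_constant n H"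
      unfolding maximal_constant_def using p by (intro SUP_upper2[OF p(1)]) simp
    show "maximal_constant n H \<le> ereal (c2 * sqrt (log 2 n))"
      unfolding maximal_constant_def c2_def
      using maximal_function_upper[OF n] by (intro SUP_least) simp
  qed (use c2 in simp_all)
qed

end
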